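(* Each of the following score sequences of tournaments on 8 vertices, and each of their dual score sequences, has an intrinsically linked representative: $(2,3,3,4,4,4,4,4)$, $(2,3,3,3,4,4,4,5)$, $(3,3,3,3,4,4,4,4)$, $(3,3,3,3,3,4,4,5)$, $(2,2,3,3,4,4,5,5)$ and $(2,2,3,4,4,4,4,5)$.
   Context: A tournament is a directed graph with exactly one directed edge between each pair of distinct vertices. Its score sequence is the list of outdegrees of its vertices in non-decreasing order. The dual of a score sequence $S$ is the score sequence of the tournament obtained by reversing all edges of a tournament with score sequence $S$; the dual of $(s_1,\dots,s_n)$ is $(n-1-s_n,\dots,n-1-s_1)$. A cycle in a directed graph is consistently oriented if it is a directed cycle. A directed graph $G$ is intrinsically linked as a directed graph if every (tame) embedding of $G$ into $S^3$ contains two vertex-disjoint consistently oriented cycles that form a non-split link. A score sequence $S$ has an intrinsically linked representative if there exists a tournament with score sequence $S$ that is intrinsically linked as a directed graph. *)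

theory Defs
  imports "HOL-Analysis.Analysis" "Graph_Theory.Arc_Walk"
begin

section \<open>Tournaments and score sequences\<close>

locale tournament = digraph +
  assumes one_direction:
    "\<lbrakk>u \<in> verts G; v \<in> verts G; u \<noteq> v\<rbrakk> \<Longrightarrow> u \<rightarrow>\<^bsub>G\<^esub> v \<longleftrightarrow> \<not> v \<rightarrow>\<^bsub>G\<^esub> u"

definition score_sequence :: "('a, 'b) pre_digraph \<Rightarrow> nat list" where
  "score_sequence G = sorted_list_of_multiset (image_mset (out_degree G) (mset_set (verts G)))"

definition dual_sequence :: "nat list \<Rightarrow> nat list" where
  "dual_sequence S = rev (map (\<lambda>s. length S - 1 - s) S)"

definition reverse_digraph :: "('a, 'b) pre_digraph \<Rightarrow> ('a, 'b) pre_digraph" where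
  "reverse_digraph G = \<lparr>verts = verts G, arcs = arcs G, tail = head G, head = tail G\<rparr>"

lemma tournament_reverse:
  assumes "tournament G"
  shows "tournament (reverse_digraph G)"
proof -
  interpret tournament G by fact
  show ?thesis
  proof
    fix u v assume "u \<in> verts (reverse_digraph G)" "v \<in> verts (reverse_digraph G)" "u \<noteq> v"
    then show "u \<rightarrow>\<^bsub>reverse_digraph G\<^esub> v \<longleftrightarrow> \<not> v \<rightarrow>\<^bsub>reverse_digraph G\<^esub> u"
      using one_direction[of u v]
      by (simp add: reverse_digraph_def arcs_ends_def arc_to_ends_def image_iff) metis
  qed (auto simp: reverse_digraph_def arc_to_ends_def no_loops[symmetric]
        intro: no_multi_arcs dest: no_loops)
qed

lemma (in tournament) out_degree_reverse:
  assumes v: "v \<in> verts G"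
  shows "out_degree (reverse_digraph G) v = card (verts G) - 1 - out_degree G v"
proof -
  let ?O = "out_arcs G v" and ?I = "in_arcs G v"
  have inj_O: "inj_on (head G) ?O" and inj_I: "inj_on (tail G) ?I"
    by (auto intro!: inj_onI no_multi_arcs simp: arc_to_ends_def)
  have out: "head G ` ?O = {w. v \<rightarrow>\<^bsub>G\<^esub> w}" and inn: "tail G ` ?I = {w. w \<rightarrow>\<^bsub>G\<^esub> v}"
    by (auto simp: arcs_ends_conv image_iff)
  have sub: "w \<in> verts G - {v}" if "v \<rightarrow>\<^bsub>G\<^esub> w \<or> w \<rightarrow>\<^bsub>G\<^esub> v" for w
    using that by (auto simp: arcs_ends_conv dest: no_loops)
  have un: "head G ` ?O \<union> tail G ` ?I = verts G - {v}"
    unfolding out inn using sub one_direction v by blast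
  have dis: "head G ` ?O \<inter> tail G ` ?I = {}"
    unfolding out inn using sub one_direction v by blast
  have fin: "finite ?O" "finite ?I"
    by (auto simp: out_arcs_def in_arcs_def)
  have "card (verts G) - 1 = card (head G ` ?O \<union> tail G ` ?I)"
    using un v by (simp add: card_Diff_singleton)
  also have "\<dots> = card ?O + card ?I"
    using card_Un_disjoint[OF _ _ dis] fin inj_O inj_I by (simp add: card_image)
  finally show ?thesis
    by (simp add: out_degree_def out_arcs_def in_arcs_def reverse_digraph_def)
qed

lemma score_sequence_reverse:
  assumes "tournament G"
  shows "score_sequence (reverse_digraph G) = dual_sequence (score_sequence G)"
proof -
  interpret tournament G by fact
  let ?n = "card (verts G)" and ?M = "image_mset (out_degree G) (mset_set (verts G))"
  let ?xs = "sorted_list_of_multiset ?M"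
  have len: "length ?xs = ?n"
    by (metis mset_sorted_list_of_multiset size_image_mset size_mset size_mset_set)
  have "mset (dual_sequence ?xs) = image_mset (\<lambda>s. ?n - 1 - s) ?M"
    by (simp add: dual_sequence_def len mset_map del: image_mset.compositionality)
  also have "\<dots> = image_mset (out_degree (reverse_digraph G)) (mset_set (verts G))"
    unfolding multiset.map_comp by (rule image_mset_cong) (simp add: out_degree_reverse)
  finally have "mset (dual_sequence ?xs)
      = image_mset (out_degree (reverse_digraph G)) (mset_set (verts G))" .
  moreover have "sorted (dual_sequence ?xs)"
    unfolding dual_sequence_def len sorted_wrt_rev sorted_wrt_map
    by (rule sorted_wrt_mono_rel[OF _ sorted_sorted_list_of_multiset]) auto
  ultimately show ?thesis
    unfolding score_sequence_def
    by (metis mset_sorted_list_of_multiset properties_for_sort reverse_digraph_def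
        pre_digraph.select_convs(1) sorted_sorted_list_of_multiset)
qed

section \<open>Tame embeddings of digraphs in the 3-sphere\<close>

abbreviation S3 :: "(real^4) set" where
  "S3 \<equiv> sphere 0 1"

text \<open>
  A topological embedding of the realisation of a digraph is given by the positions
  \<open>\<phi> v\<close> of the vertices and parametrised curves \<open>\<gamma> e\<close> for the arcs.  As \<open>\<phi>\<close> is injective,
  \<open>simple_path (\<gamma> e)\<close> makes \<open>\<gamma> e\<close> an arc unless \<open>e\<close> is a loop.
\<close>

definition digraph_embedding ::
  "('a, 'b) pre_digraph \<Rightarrow> ('a \<Rightarrow> real^4) \<Rightarrow> ('b \<Rightarrow> real \<Rightarrow> real^4) \<Rightarrow> bool" where
  "digraph_embedding G \<phi> \<gamma> \<longleftrightarrow>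
     inj_on \<phi> (verts G) \<and> \<phi> ` verts G \<subseteq> S3 \<and>
     (\<forall>e\<in>arcs G. simple_path (\<gamma> e) \<and> path_image (\<gamma> e) \<subseteq> S3 \<and>
        pathstart (\<gamma> e) = \<phi> (tail G e) \<and> pathfinish (\<gamma> e) = \<phi> (head G e) \<and>
        path_image (\<gamma> e) \<inter> \<phi> ` verts G = \<phi> ` {tail G e, head G e}) \<and>
     (\<forall>e\<in>arcs G. \<forall>e'\<in>arcs G. e \<noteq> e' \<longrightarrow>
        path_image (\<gamma> e) \<inter> path_image (\<gamma> e')
          \<subseteq> \<phi> ` ({tail G e, head G e} \<inter> {tail G e', head G e'}))"

definition polygonal :: "(real^3) set \<Rightarrow> bool" where
  "polygonal A \<longleftrightarrow> (\<exists>I. finite I \<and> A = (\<Union>(a, b)\<in>I. closed_segment a b))"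

text \<open>
  Tame means that a self-homeomorphism of the 3-sphere makes all arcs polygonal.  As the embedded
  graph misses a point \<open>p\<close> of the sphere, polygonality can be read off in \<open>\<real>\<^sup>3\<close>: homeomorphisms
  from the sphere minus \<open>p\<close> to \<open>\<real>\<^sup>3\<close> are exactly the restrictions of self-homeomorphisms of
  the sphere followed by stereographic projection from the image of \<open>p\<close>.
\<close>

definition tame_embedding ::
  "('a, 'b) pre_digraph \<Rightarrow> ('a \<Rightarrow> real^4) \<Rightarrow> ('b \<Rightarrow> real \<Rightarrow> real^4) \<Rightarrow> bool" where
  "tame_embedding G \<phi> \<gamma> \<longleftrightarrow> digraph_embedding G \<phi> \<gamma> \<and>
     (\<exists>p h k. p \<in> S3 - (\<phi> ` verts G \<union> (\<Union>e\<in>arcs G. path_image (\<gamma> e))) \<and>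
        homeomorphism (S3 - {p}) (UNIV :: (real^3) set) h k \<and>
        (\<forall>e\<in>arcs G. polygonal (h ` path_image (\<gamma> e))))"

section \<open>Intrinsic linking\<close>

text \<open>
  The separating 2-sphere may be any embedded topological sphere; by Bing's approximation
  theorem, requiring it to be tame gives the same notion of a split link.
\<close>

definition split_link :: "(real^4) set \<Rightarrow> (real^4) set \<Rightarrow> bool" where
  "split_link K L \<longleftrightarrow>
     (\<exists>F U V. F \<subseteq> S3 \<and> F homeomorphic sphere (0 :: real^3) 1 \<and>
        U \<in> components (S3 - F) \<and> V \<in> components (S3 - F) \<and> U \<noteq> V \<and> K \<subseteq> U \<and> L \<subseteq> V)"

definition cycle_verts :: "('a, 'b) pre_digraph \<Rightarrow> 'b awalk \<Rightarrow> 'a set" where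
  "cycle_verts G c = tail G ` set c \<union> head G ` set c"

definition cycle_image :: "('b \<Rightarrow> real \<Rightarrow> real^4) \<Rightarrow> 'b awalk \<Rightarrow> (real^4) set" where
  "cycle_image \<gamma> c = (\<Union>e\<in>set c. path_image (\<gamma> e))"

definition intrinsically_linked :: "('a, 'b) pre_digraph \<Rightarrow> bool" where
  "intrinsically_linked G \<longleftrightarrow>
     (\<forall>\<phi> \<gamma>. tame_embedding G \<phi> \<gamma> \<longrightarrow>
        (\<exists>c d. pre_digraph.cycle G c \<and> pre_digraph.cycle G d \<and>
           cycle_verts G c \<inter> cycle_verts G d = {} \<and>
           \<not> split_link (cycle_image \<gamma> c) (cycle_image \<gamma> d)))"

text \<open>Every finite tournament is isomorphic to one with vertices in \<open>nat\<close> and arcs in \<open>nat \<times> nat\<close>.\<close>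

definition has_intrinsically_linked_representative :: "nat list \<Rightarrow> bool" where
  "has_intrinsically_linked_representative S \<longleftrightarrow>
     (\<exists>G :: (nat, nat \<times> nat) pre_digraph.
        tournament G \<and> score_sequence G = S \<and> intrinsically_linked G)"

end

theory Submission
  imports Defs
begin

text \<open>Only seven different sequences occur among the six sequences and their duals, and one digraph
\<open>H\<close> on the vertices \<open>0, \<dots>, 7\<close> lies inside tournaments with all seven score sequences: it has all
arcs from \<open>{0, 1, 2}\<close> to \<open>{3, 4}\<close>, from there to \<open>{5, 6, 7}\<close> and from there back to \<open>{0, 1, 2}\<close>,
except that the arc between \<open>2\<close> and \<open>7\<close> is reversed (\<open>core_arcs\<close>).  Intrinsic linking is
inherited by larger digraphs, so it is enough to link two disjoint directed cycles of \<open>H\<close> in every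
embedding.

This is a parity argument in the spirit of Conway and Gordon, summing linking numbers mod 2 over
twenty pairs of cycles (\<open>linked_cycles\<close>).  In a generic vertical projection of a polygonal drawing
the linking number of \<open>C\<close> and \<open>D\<close> is, mod 2, the sum over the arcs \<open>e\<close> of \<open>C\<close> and \<open>e'\<close> of \<open>D\<close> of the number of
times that \<open>e'\<close> passes over \<open>e\<close>.  In the twenty pairs, \<open>e\<close> is opposite to \<open>e'\<close> as often as
\<open>e'\<close> is to \<open>e\<close>, mod 2; hence only the crossing numbers of the plane projections enter the total.
The crossing number of two segments is a combination of the four angles under which each segment is
seen from the ends of the other (\<open>angle_defect_crossing\<close>).  These angles add up along an arc, so
that mod 2 the crossing number of two arcs is a term determined by the order of the labels of their
ends (\<open>interlacing\<close>) plus, for each end of either arc, the number of turns that the other arc makes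
around it (\<open>arc_crossing_parity\<close>).  Around a closed walk each vertex ends two arcs, and the turns
cancel mod 2.  What remains is a number attached to the list of pairs alone; it is odd, so some pair has odd
linking number (\<open>linking_certificate_obstruction\<close>).

It remains to see that a split pair has an even number of overcrossings, even though the separating
sphere \<open>F\<close> may be wild.  For a closed polygon \<open>K\<close> in \<open>\<real>\<^sup>3\<close> there is an explicit continuous function to
\<open>\<complex> - {0}\<close>, defined off \<open>K\<close>, whose argument is half the solid angle subtended by \<open>K\<close>: the trace of the
product of the matrices \<open>|v| + v \<cdot> \<sigma>\<close> (with \<open>\<sigma>\<close> the Pauli matrices), \<open>v\<close> running over the vectors
to the vertices of \<open>K\<close> (\<open>holonomy\<close>).  Along a closed polygon \<open>L\<close> its argument changes by
\<open>2 \<pi>\<close> times the linking number; so if the function has a continuous logarithm along \<open>L\<close>, the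
overcrossings are even in number (\<open>overcrossings_even\<close>).  If \<open>K\<close> and \<open>L\<close> lie on different sides of
\<open>F\<close>, such a logarithm exists: it exists on \<open>F\<close> because \<open>F\<close>, even with a point removed, admits
logarithms; by Tietze's theorem the function then extends from the side of \<open>L\<close> to all of \<open>\<real>\<^sup>3\<close>, which
admits logarithms too (\<open>components_logarithmically_separated\<close>).  Since the sides are open,
the arcs of an arbitrary embedding may be replaced by nearby polygons in general position.\<close>

section \<open>Polygonal walks as lists\<close>

definition steps :: "'a list \<Rightarrow> ('a \<times> 'a) list" where
  "steps xs = zip xs (tl xs)"

lemma steps_simps [simp]:
  "steps [] = []" "steps [x] = []" "steps (x # y # xs) = (x, y) # steps (y # xs)"
  by (simp_all add: steps_def)

lemma steps_append:
  assumes "xs \<noteq> []" "ys \<noteq> []" "last xs = hd ys"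
  shows "steps (xs @ tl ys) = steps xs @ steps ys"
  using assms
proof (induction xs rule: induct_list012)
  case (2 x)
  then show ?case by (cases ys) auto
qed auto

lemma steps_snoc: "xs \<noteq> [] \<Longrightarrow> steps (xs @ [y]) = steps xs @ [(last xs, y)]"
  by (induction xs rule: induct_list012) auto

lemma steps_map: "steps (map f xs) = map (map_prod f f) (steps xs)"
  by (induction xs rule: induct_list012) auto

lemma set_steps: "(a, b) \<in> set (steps xs) \<Longrightarrow> a \<in> set xs \<and> b \<in> set xs"
  by (induction xs rule: induct_list012) auto

lemma sum_list_steps_telescope:
  fixes g :: "'a \<Rightarrow> 'b::ab_group_add"
  shows "xs \<noteq> [] \<Longrightarrow> (\<Sum>(a, b)\<leftarrow>steps xs. g b - g a) = g (last xs) - g (hd xs)"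
  by (induction xs rule: induct_list012) auto

lemma sum_list_steps_telescope':
  fixes g :: "'a \<Rightarrow> 'b::ab_group_add"
  shows "xs \<noteq> [] \<Longrightarrow> (\<Sum>(a, b)\<leftarrow>steps xs. g a - g b) = g (hd xs) - g (last xs)"
  using sum_list_steps_telescope[of xs "\<lambda>x. - g x"] by simp

lemma steps_nonempty_iff: "steps xs \<noteq> [] \<longleftrightarrow> length xs \<ge> 2"
  by (induction xs rule: induct_list012) auto

lemma set_subset_steps: "length xs \<ge> 2 \<Longrightarrow> set xs = fst ` set (steps xs) \<union> snd ` set (steps xs)"
proof (induction xs rule: induct_list012)
  case (3 x y zs)
  then show ?case by (cases zs) auto
qed auto

lemma steps_map_upt: "steps (map f [0..<Suc n]) = map (\<lambda>j. (f j, f (Suc j))) [0..<n]"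
proof (induction n)
  case (Suc n)
  have "steps (map f [0..<Suc n] @ [f (Suc n)]) = steps (map f [0..<Suc n]) @ [(last (map f [0..<Suc n]), f (Suc n))]"
    by (rule steps_snoc) simp
  then show ?case unfolding Suc by simp
qed simp

text \<open>The first vertex is repeated at the end, so that \<open>steps\<close> also yields the closing edge.\<close>

definition closed_walk :: "'v list \<Rightarrow> bool" where
  "closed_walk C \<longleftrightarrow> length C \<ge> 2 \<and> last C = hd C"

section \<open>Sides of a sphere and continuous logarithms\<close>

text \<open>A sphere is simply connected, and with a point removed it is a plane.  The puncture is needed because
  the point that is sent to infinity may lie on the separating sphere.\<close>

lemma Borsukian_punctured_sphere:
  fixes F :: "'a::real_normed_vector set"
  assumes "F homeomorphic sphere (0 :: real^3) 1"
  shows "Borsukian (F - {p})"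
proof (cases "p \<in> F")
  case False
  then show ?thesis
    using assms Borsukian_sphere[of "0 :: real^3" 1] homeomorphic_Borsukian_eq by fastforce
next
  case True
  obtain f g where fg: "homeomorphism F (sphere (0 :: real^3) 1) f g"
    using assms by (auto simp: homeomorphic_def)
  have "F - {p} homeomorphic f ` (F - {p})"
    using homeomorphism_of_subsets[OF fg, of "F - {p}"] by (auto simp: homeomorphic_def)
  also have "f ` (F - {p}) = sphere 0 1 - {f p}"
    using fg True inj_on_image_set_diff[of f F F "{p}"] unfolding homeomorphism_def
    by (metis Diff_subset empty_subsetI image_empty image_insert inj_on_inverseI insert_subset)
  also have "\<dots> homeomorphic {x :: real^3. axis 1 1 \<bullet> x = 0}"
  proof (rule homeomorphic_punctured_sphere_hyperplane)
    show "f p \<in> sphere 0 1"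
      using fg True unfolding homeomorphism_def by blast
  qed (simp_all add: axis_eq_0_iff)
  finally show ?thesis
    using homeomorphic_Borsukian_eq convex_imp_Borsukian[OF convex_hyperplane] by blast
qed

text \<open>The property of the two sides of a sphere through which splitting is used: it transports along
  homeomorphisms, and it makes winding numbers around a curve in \<open>U\<close> vanish along curves in \<open>V\<close>.\<close>

definition logarithmically_separated :: "'a::topological_space set \<Rightarrow> 'a set \<Rightarrow> bool" where
  "logarithmically_separated U V \<longleftrightarrow> open U \<and> open V \<and> U \<inter> V = {} \<and>
     (\<forall>\<theta> :: 'a \<Rightarrow> complex. continuous_on (- U) \<theta> \<and> 0 \<notin> \<theta> ` (- U) \<longrightarrow>
        (\<exists>l. continuous_on V l \<and> (\<forall>x\<in>V. \<theta> x = exp (l x))))"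

text \<open>A Mayer--Vietoris argument for maps to \<open>\<complex> - {0}\<close>.  Write \<open>M - {p}\<close> as the union of the closed sets
  \<open>A\<close>, everything outside \<open>U\<close>, and \<open>B\<close>, the side \<open>U\<close> with its boundary; they meet in \<open>F - {p}\<close>.  A
  nonvanishing function on \<open>A\<close> has a logarithm on \<open>A \<inter> B\<close>, which extends to \<open>B\<close>.  The function therefore
  extends to \<open>M - {p}\<close>, which is homeomorphic to a vector space, and so has a logarithm there.\<close>

lemma components_logarithmically_separated:
  fixes M :: "'a::euclidean_space set" and h :: "'a \<Rightarrow> 'b::real_normed_vector"
  assumes lc: "locally connected M" and F: "F \<subseteq> M" "compact F" "Borsukian (F - {p})"
    and UV: "U \<in> components (M - F)" "V \<in> components (M - F)" "U \<noteq> V"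
    and KL: "K \<subseteq> U" "L \<subseteq> V" and p: "p \<notin> K \<union> L"
    and hom: "homeomorphism (M - {p}) UNIV h k"
  shows "\<exists>U V. logarithmically_separated U V \<and> h ` K \<subseteq> U \<and> h ` L \<subseteq> V"
proof -
  have opn: "openin (top_of_set M) (M - F)"
    unfolding openin_open using F(2)
    by (intro exI[of _ "- F"]) (auto dest: compact_imp_closed)
  have lc': "locally connected (M - F)"
    by (rule locally_open_subset[OF lc opn])
  have comp_open: "openin (top_of_set M) W" if "W \<in> components (M - F)" for W
    using openin_components_locally_connected[OF lc' that] opn openin_trans by blast
  define S where "S = M - {p}"
  have sub: "U \<subseteq> M - F" "V \<subseteq> M - F"
    using UV in_components_subset by auto
  have disj: "U \<inter> V = {}"
    using UV components_nonoverlap by blast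
  have cont_h: "continuous_on S h" "continuous_on UNIV k"
    and kh: "\<And>x. x \<in> S \<Longrightarrow> k (h x) = x" "\<And>y. h (k y) = y" and rk: "range k = S"
    using hom[folded S_def] unfolding homeomorphism_def by simp_all
  have kS: "k y \<in> S" for y
    using rk by blast
  \<comment> \<open>Being open in \<open>M - {p}\<close>, the sides have open images.\<close>
  have open_h: "open (h ` (W - {p}))" if W: "openin (top_of_set M) W" for W
  proof -
    have "openin (top_of_set S) (W - {p})"
    proof -
      obtain T where T: "open T" "W = M \<inter> T" using W unfolding openin_open by blast
      then have "W - {p} = S \<inter> T" by (auto simp: S_def)
      then show ?thesis unfolding openin_open using T(1) by blast
    qed
    then have "openin (top_of_set UNIV) (h ` (W - {p}))"
      using homeomorphism_imp_open_map[OF hom[folded S_def]] by blast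
    then show ?thesis by simp
  qed
  have BS: "Borsukian S"
    using hom Borsukian_UNIV homeomorphic_Borsukian_eq unfolding S_def homeomorphic_def by blast
  define A where "A = S - U"
  define B where "B = S \<inter> (U \<union> F)"
  \<comment> \<open>The other sides are open, so \<open>U\<close> together with \<open>F\<close> is closed.\<close>
  have "\<exists>W. openin (top_of_set M) W \<and> U \<union> F = M - W"
  proof (intro exI conjI)
    show "openin (top_of_set M) (\<Union>(components (M - F) - {U}))"
      by (rule openin_Union) (auto intro: comp_open)
    show "U \<union> F = M - \<Union>(components (M - F) - {U})"
    proof -
      have "M - F = \<Union>(components (M - F))" by (metis Union_components)
      moreover have "\<And>W. W \<in> components (M - F) - {U} \<Longrightarrow> U \<inter> W = {}"
        using UV(1) components_nonoverlap by blast
      ultimately show ?thesis using F(1) sub(1) by blast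
    qed
  qed
  then obtain W T where W: "U \<union> F = M - W" "W = M \<inter> T" "open T"
    unfolding openin_open by blast
  then have B_closed: "closedin (top_of_set S) B"
    unfolding closedin_closed B_def
    by (intro exI[of _ "- T"]) (auto simp: S_def)
  have A_closed: "closedin (top_of_set S) A"
  proof -
    obtain T where T: "open T" "U = M \<inter> T" using comp_open[OF UV(1)] unfolding openin_open by blast
    then show ?thesis
      unfolding closedin_closed A_def by (intro exI[of _ "- T"]) (auto simp: S_def)
  qed
  have AB: "A \<union> B = S" "A \<inter> B = F - {p}"
    using F(1) sub(1) unfolding A_def B_def S_def by auto
  have F_closed: "closedin (top_of_set S) (F - {p})"
    using A_closed B_closed AB(2) by (metis closedin_Int)
  show ?thesis
  proof (intro exI conjI)
    show "h ` K \<subseteq> h ` (U - {p})" "h ` L \<subseteq> h ` (V - {p})"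
      using KL p by auto
    show "logarithmically_separated (h ` (U - {p})) (h ` (V - {p}))"
      unfolding logarithmically_separated_def
    proof (intro conjI allI impI)
      show "open (h ` (U - {p}))" "open (h ` (V - {p}))"
        by (auto intro!: open_h comp_open UV)
      have inj: "inj_on h S" by (metis inj_on_inverseI kh(1))
      show "h ` (U - {p}) \<inter> h ` (V - {p}) = {}"
        using inj_on_image_Int[OF inj, of "U - {p}" "V - {p}"] disj sub unfolding S_def by blast
      fix \<theta> :: "'b \<Rightarrow> complex"
      assume "continuous_on (- h ` (U - {p})) \<theta> \<and> 0 \<notin> \<theta> ` (- h ` (U - {p}))"
      then have \<theta>: "continuous_on (- h ` (U - {p})) \<theta>" "\<And>x. x \<notin> h ` (U - {p}) \<Longrightarrow> \<theta> x \<noteq> 0"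
        by (auto simp: image_iff)
      have hA: "h x \<notin> h ` (U - {p})" if "x \<in> A" for x
        using that sub inj_on_image_mem_iff[OF inj, of x "U - {p}"] unfolding A_def S_def by blast
      have cA: "continuous_on A (\<theta> \<circ> h)"
        by (rule continuous_on_compose[OF continuous_on_subset[OF cont_h(1)]
              continuous_on_subset[OF \<theta>(1)]])
          (use hA A_closed in \<open>auto dest: closedin_imp_subset\<close>)
      have nz: "\<theta> (h x) \<noteq> 0" if "x \<in> A" for x
        using hA[OF that] \<theta>(2) by blast
      have "\<exists>g. continuous_on (F - {p}) g \<and> (\<forall>x\<in>F - {p}. (\<theta> \<circ> h) x = exp (g x))"
      proof -
        have "continuous_on (F - {p}) (\<theta> \<circ> h)"
          using AB(2) by (metis Int_lower1 cA continuous_on_subset)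
        moreover have "(\<theta> \<circ> h) \<in> (F - {p}) \<rightarrow> - {0}"
          using AB(2) nz by (metis ComplI IntD1 Pi_I comp_apply singletonD)
        ultimately show ?thesis
          using F(3) unfolding Borsukian_continuous_logarithm by blast
      qed
      then obtain g where g: "continuous_on (F - {p}) g" "\<And>x. x \<in> F - {p} \<Longrightarrow> (\<theta> \<circ> h) x = exp (g x)"
        by blast
      obtain g' where g': "continuous_on S g'" "\<And>x. x \<in> F - {p} \<Longrightarrow> g' x = g x"
        using Tietze_unbounded[OF g(1) F_closed] by blast
      define \<Theta> where "\<Theta> = (\<lambda>x. if x \<in> A then (\<theta> \<circ> h) x else exp (g' x))"
      have "continuous_on (A \<union> B) \<Theta>"
        unfolding \<Theta>_def
      proof (rule continuous_on_cases_local)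
        show "closedin (top_of_set (A \<union> B)) A" "closedin (top_of_set (A \<union> B)) B"
          using A_closed B_closed AB(1) by auto
        show "continuous_on B (\<lambda>x. exp (g' x))"
          using g'(1) AB(1) by (metis Un_upper2 continuous_on_exp continuous_on_subset)
        fix x assume "x \<in> A \<and> x \<notin> A \<or> x \<in> B \<and> x \<in> A"
        then have "x \<in> F - {p}" using AB(2) by blast
        then show "(\<theta> \<circ> h) x = exp (g' x)" using g g' by auto
      qed (use cA in auto)
      moreover have "\<Theta> \<in> S \<rightarrow> - {0}"
        by (auto simp: \<Theta>_def nz)
      ultimately obtain l where l: "continuous_on S l" "\<And>x. x \<in> S \<Longrightarrow> \<Theta> x = exp (l x)"
        using BS AB(1) unfolding Borsukian_continuous_logarithm by metis
      show "\<exists>l. continuous_on (h ` (V - {p})) l \<and> (\<forall>x\<in>h ` (V - {p}). \<theta> x = exp (l x))"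
      proof (intro exI conjI ballI)
        show "continuous_on (h ` (V - {p})) (l \<circ> k)"
          by (rule continuous_on_compose[OF continuous_on_subset[OF cont_h(2)]
                continuous_on_subset[OF l(1)]]) (use kS in \<open>auto simp: kh\<close>)
        fix x assume "x \<in> h ` (V - {p})"
        then obtain y where y: "y \<in> V" "y \<noteq> p" "x = h y" by auto
        then have yS: "y \<in> S" "y \<in> A" using sub disj by (auto simp: S_def A_def)
        then show "\<theta> x = exp ((l \<circ> k) x)"
          using l(2)[OF yS(1)] y by (simp add: kh \<Theta>_def)
      qed
    qed
  qed
qed

lemma split_link_logarithmically_separated:
  fixes h :: "real^4 \<Rightarrow> 'a::real_normed_vector"
  assumes "split_link K L" "p \<notin> K \<union> L" "homeomorphism (S3 - {p}) UNIV h k"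
  shows "\<exists>U V. logarithmically_separated U V \<and> h ` K \<subseteq> U \<and> h ` L \<subseteq> V"
proof -
  obtain F U V where F: "F \<subseteq> S3" "F homeomorphic sphere (0 :: real^3) 1"
    and UV: "U \<in> components (S3 - F)" "V \<in> components (S3 - F)" "U \<noteq> V" "K \<subseteq> U" "L \<subseteq> V"
    using assms(1) unfolding split_link_def by blast
  have "compact F"
    using F(2) homeomorphic_compactness by fastforce
  then show ?thesis
    using components_logarithmically_separated[OF locally_connected_sphere F(1) _
        Borsukian_punctured_sphere[OF F(2)] UV assms(2,3)] by blast
qed

section \<open>The half solid angle subtended by a polygon\<close>

text \<open>Three-space as horizontal plane times vertical axis: the projection of a point is its first component.\<close>

type_synonym space = "complex \<times> real"

text \<open>A vector of \<open>\<complex>\<^sup>2\<close> spanning the image of the projector \<open>proj v\<close>, unless \<open>v\<close> points straight down, where it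
  is zero.\<close>

definition spinor :: "space \<Rightarrow> complex \<times> complex" where
  "spinor v = (of_real (norm v + snd v), fst v)"

definition herm :: "complex \<times> complex \<Rightarrow> complex \<times> complex \<Rightarrow> complex" where
  "herm \<phi> \<psi> = cnj (fst \<phi>) * fst \<psi> + cnj (snd \<phi>) * snd \<psi>"

text \<open>Its argument is half the signed solid angle of the spherical triangle spanned by the upward direction,
  \<open>v\<close> and \<open>w\<close>.\<close>

definition bracket :: "space \<Rightarrow> space \<Rightarrow> complex" where
  "bracket v w = herm (spinor v) (spinor w)"

text \<open>The action on \<open>\<complex>\<^sup>2\<close> of the matrix \<open>|v| + v \<cdot> \<sigma>\<close>, a multiple of a projector of rank one.\<close>

definition proj :: "space \<Rightarrow> complex \<times> complex \<Rightarrow> complex \<times> complex" where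
  "proj v u = (of_real (norm v + snd v) * fst u + cnj (fst v) * snd u,
     fst v * fst u + of_real (norm v - snd v) * snd u)"

text \<open>The trace of the product of the matrices of the listed vectors.  As a cyclic product of
  projectors of rank one it is, up to positive factors, the product of the Hermitian products of
  consecutive spinors, whichever spinors are chosen to represent the directions.\<close>

definition holonomy :: "space list \<Rightarrow> complex" where
  "holonomy vs = fst (foldr proj vs (1, 0)) + snd (foldr proj vs (0, 1))"

text \<open>The determinant of \<open>proj v\<close> vanishes.\<close>

lemma norm_space: "(norm v + snd v) * (norm v - snd v) = (norm (fst v))\<^sup>2" for v :: space
  by (simp add: norm_prod_def square_diff_square_factored[symmetric] power2_eq_square[symmetric])

lemma norm_space_nonneg: "norm v + snd v \<ge> 0" "norm v - snd v \<ge> 0" for v :: space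
  using norm_snd_le[of "snd v" "fst v"] by (auto simp: abs_le_iff)

lemma continuous_on_holonomy: "continuous_on A (\<lambda>x. holonomy (map (\<lambda>k. k - x) ks))"
proof -
  have "continuous_on A (\<lambda>x. foldr proj (map (\<lambda>k. k - x) ks) u)" for u
    by (induction ks) (auto simp: proj_def intro!: continuous_intros)
  then show ?thesis
    unfolding holonomy_def by (auto intro!: continuous_intros)
qed

text \<open>A product of matrices of rank one collapses to scalar products.  The spinors \<open>\<phi> v\<close> are left open because
  no choice depends continuously on all directions: two different ones are used below.\<close>

lemma holonomy_factor:
  assumes "vs \<noteq> []"
    and fac: "\<And>v u. v \<in> set vs \<Longrightarrow>
        c v * fst (proj v u) = herm (\<phi> v) u * fst (\<phi> v) \<and>
        c v * snd (proj v u) = herm (\<phi> v) u * snd (\<phi> v)"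
  shows "(\<Prod>v\<leftarrow>vs. c v) * holonomy vs = (\<Prod>(v, w)\<leftarrow>steps (vs @ [hd vs]). herm (\<phi> v) (\<phi> w))"
proof -
  define R where "R = (\<lambda>vs. \<Prod>(v, w)\<leftarrow>steps vs. herm (\<phi> v) (\<phi> w))"
  have chain: "(\<Prod>v\<leftarrow>vs. c v) * fst (foldr proj vs u) = R vs * herm (\<phi> (last vs)) u * fst (\<phi> (hd vs)) \<and>
        (\<Prod>v\<leftarrow>vs. c v) * snd (foldr proj vs u) = R vs * herm (\<phi> (last vs)) u * snd (\<phi> (hd vs))" for u
    using assms
  proof (induction vs rule: induct_list012)
    case (2 v)
    then show ?case by (simp add: R_def)
  next
    case (3 v w vs)
    let ?C = "\<Prod>v\<leftarrow>w # vs. c v" and ?y = "foldr proj (w # vs) u"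
      and ?L = "herm (\<phi> (last (w # vs))) u"
    have IH: "?C * fst ?y = R (w # vs) * ?L * fst (\<phi> w)" "?C * snd ?y = R (w # vs) * ?L * snd (\<phi> w)"
      using "3.IH"(2) "3.prems"(2) by auto
    have "?C * herm (\<phi> v) ?y = cnj (fst (\<phi> v)) * (?C * fst ?y) + cnj (snd (\<phi> v)) * (?C * snd ?y)"
      unfolding herm_def by (simp only: algebra_simps)
    also have "\<dots> = R (w # vs) * ?L * herm (\<phi> v) (\<phi> w)"
      unfolding IH herm_def by (simp add: algebra_simps)
    also have "\<dots> = R (v # w # vs) * ?L"
      by (simp add: R_def)
    finally have key: "?C * herm (\<phi> v) ?y = R (v # w # vs) * ?L" .
    have "(\<Prod>v\<leftarrow>v # w # vs. c v) * fst (foldr proj (v # w # vs) u) = ?C * (c v * fst (proj v ?y))"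
      "(\<Prod>v\<leftarrow>v # w # vs. c v) * snd (foldr proj (v # w # vs) u) = ?C * (c v * snd (proj v ?y))"
      by simp_all
    moreover have "c v * fst (proj v ?y) = herm (\<phi> v) ?y * fst (\<phi> v)"
      "c v * snd (proj v ?y) = herm (\<phi> v) ?y * snd (\<phi> v)"
      using "3.prems"(2)[of v] by auto
    moreover have "last (v # w # vs) = last (w # vs)" "hd (v # w # vs) = v"
      by simp_all
    ultimately show ?case
      using key by (simp only: mult.assoc[symmetric])
  qed simp
  have "(\<Prod>v\<leftarrow>vs. c v) * holonomy vs
      = R vs * (herm (\<phi> (last vs)) (1, 0) * fst (\<phi> (hd vs)) + herm (\<phi> (last vs)) (0, 1) * snd (\<phi> (hd vs)))"
    unfolding holonomy_def distrib_left using chain by (simp add: mult.assoc)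
  also have "\<dots> = R vs * herm (\<phi> (last vs)) (\<phi> (hd vs))"
    by (simp add: herm_def)
  also have "\<dots> = R (vs @ [hd vs])"
    using assms(1) by (simp add: R_def steps_snoc)
  finally show ?thesis by (simp add: R_def)
qed

lemma proj_spinor:
  "of_real (norm v + snd v) * fst (proj v u) = herm (spinor v) u * fst (spinor v)"
  "of_real (norm v + snd v) * snd (proj v u) = herm (spinor v) u * snd (spinor v)"
proof -
  have "complex_of_real ((norm v + snd v) * (norm v - snd v)) = cnj (fst v) * fst v"
    by (metis norm_space complex_norm_square mult.commute)
  then show "of_real (norm v + snd v) * snd (proj v u) = herm (spinor v) u * snd (spinor v)"
    by (simp add: proj_def herm_def spinor_def algebra_simps)
qed (simp add: proj_def herm_def spinor_def algebra_simps)

text \<open>With the spinor that is singular straight below, the half solid angle splits into contributions of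
  the single edges of the polygon.\<close>

lemma holonomy_eq_bracket:
  assumes "vs \<noteq> []"
  shows "of_real (\<Prod>v\<leftarrow>vs. norm v + snd v) * holonomy vs = (\<Prod>(v, w)\<leftarrow>steps (vs @ [hd vs]). bracket v w)"
proof -
  have "of_real (\<Prod>v\<leftarrow>vs. norm v + snd v) = (\<Prod>v\<leftarrow>vs. complex_of_real (norm v + snd v))"
    by (induction vs) auto
  then show ?thesis
    unfolding bracket_def by (simp only: holonomy_factor[OF assms] proj_spinor)
qed

lemma zero_in_segment_antipodal:
  fixes v :: "'a::real_normed_vector"
  assumes "w = - l *\<^sub>R v" "l \<ge> 0"
  shows "0 \<in> closed_segment v w"
  unfolding in_segment
  by (rule exI[of _ "1 / (1 + l)"]) (use assms in \<open>auto simp: field_simps simp flip: scaleR_left_distrib scaleR_diff_left\<close>)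

text \<open>Spinors are orthogonal only if the directions that they represent are opposite.\<close>

lemma bracket_zero_imp_antipodal:
  assumes v: "norm v + snd v \<noteq> 0" and w: "norm w + snd w \<noteq> 0" and "bracket v w = 0"
  shows "0 \<in> closed_segment v w"
proof -
  define s where "s = norm v + snd v"
  define t where "t = norm v - snd v"
  define s' where "s' = norm w + snd w"
  define t' where "t' = norm w - snd w"
  have pos: "s > 0" "s' > 0" "t \<ge> 0" "t' \<ge> 0"
    using v w norm_space_nonneg[of v] norm_space_nonneg[of w] unfolding s_def s'_def t_def t'_def by auto
  have st: "s * t = (norm (fst v))\<^sup>2" "s' * t' = (norm (fst w))\<^sup>2"
    unfolding s_def t_def s'_def t'_def by (rule norm_space)+
  have eq: "cnj (fst v) * fst w = - of_real (s * s')"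
    using assms(3) unfolding bracket_def herm_def spinor_def s_def s'_def
    by (simp add: add_eq_0_iff2)
  have "norm (cnj (fst v) * fst w) = s * s'"
    unfolding eq norm_minus_cancel norm_of_real using pos by simp
  then have nn: "(norm (fst v))\<^sup>2 * (norm (fst w))\<^sup>2 = (s * s')\<^sup>2"
    by (simp add: norm_mult power_mult_distrib[symmetric])
  have tt: "t * t' = s * s'"
  proof -
    have "(s * s') * (t * t') = (s * s') * (s * s')"
      using nn unfolding st[symmetric] by (simp add: power2_eq_square algebra_simps)
    then show ?thesis using pos by (metis mult_left_cancel mult_pos_pos less_irrefl)
  qed
  have "t > 0" using tt pos by (metis less_eq_real_def mult_pos_pos mult_zero_left less_irrefl)
  \<comment> \<open>From here on, \<open>w = - l v\<close> is read off from \<open>s' = l t\<close> and \<open>t' = l s\<close>.\<close>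
  define l where "l = s' / t"
  have l: "l > 0" "s' = l * t" "t' = l * s"
    using \<open>t > 0\<close> pos tt unfolding l_def by (auto simp: field_simps)
  have "snd w = - l * snd v"
  proof -
    have "snd w = (s' - t') / 2" and v: "snd v = (s - t) / 2"
      unfolding s_def t_def s'_def t'_def by auto
    then show ?thesis
      unfolding v l(2,3) by (simp add: field_simps)
  qed
  moreover have "fst w = - l *\<^sub>R fst v"
  proof -
    have "of_real (s * t) * fst w = fst v * (cnj (fst v) * fst w)"
      unfolding st by (simp add: complex_norm_square[symmetric] mult.assoc[symmetric] del: of_real_power)
    also have "\<dots> = of_real (s * t) * (- l *\<^sub>R fst v)"
      unfolding eq l(2) by (simp add: scaleR_conv_of_real)
    finally have "of_real (s * t) * fst w = of_real (s * t) * (- l *\<^sub>R fst v)" .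
    moreover have "complex_of_real (s * t) \<noteq> 0" using pos \<open>t > 0\<close> by simp
    ultimately show ?thesis using mult_left_cancel by blast
  qed
  ultimately have "w = - l *\<^sub>R v"
    by (simp add: prod_eq_iff)
  then show ?thesis by (rule zero_in_segment_antipodal) (use l(1) in simp)
qed

lemma downward: "norm v + snd v = 0 \<Longrightarrow> fst v = 0 \<and> snd v \<le> 0" for v :: space
  using norm_space[of v] norm_ge_zero[of v] by (auto simp: add_eq_0_iff2)

lemma axial: "fst v = 0 \<Longrightarrow> norm v = \<bar>snd v\<bar>" for v :: space
  by (simp add: norm_prod_def)

text \<open>The product vanishes only if two consecutive directions are opposite, that is, if the origin
  lies on an edge.\<close>

lemma holonomy_nonzero:
  assumes "vs \<noteq> []" and off: "\<And>v w. (v, w) \<in> set (steps (vs @ [hd vs])) \<Longrightarrow> 0 \<notin> closed_segment v w"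
  shows "holonomy vs \<noteq> 0"
proof -
  have nz: "v \<noteq> 0" if v: "v \<in> set vs" for v
  proof -
    have "\<exists>w. (v, w) \<in> set (steps (xs @ [y]))" if "v \<in> set xs" for xs y
      using that by (induction xs rule: induct_list012) auto
    then show ?thesis using off v by fastforce
  qed
  \<comment> \<open>Straight below, \<open>spinor\<close> vanishes and is replaced by the second basis vector.\<close>
  define reg where "reg = (\<lambda>v::space. norm v + snd v \<noteq> 0)"
  define \<phi> where "\<phi> = (\<lambda>v. if reg v then spinor v else (0, 1))"
  define c where "c = (\<lambda>v::space. if reg v then norm v + snd v else 1 / (norm v - snd v))"
  have fac: "of_real (c v) * fst (proj v u) = herm (\<phi> v) u * fst (\<phi> v) \<and>
        of_real (c v) * snd (proj v u) = herm (\<phi> v) u * snd (\<phi> v)" if v: "v \<in> set vs" for v u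
  proof (cases "reg v")
    case True
    then show ?thesis unfolding \<phi>_def c_def using proj_spinor[of v u] by simp
  next
    case False
    then have "norm v + snd v = 0" "fst v = 0"
      using downward[of v] unfolding reg_def by auto
    moreover have "norm v > 0" using nz[OF v] by simp
    then have "norm v \<noteq> snd v" using calculation(1) by linarith
    ultimately show ?thesis
      using False unfolding \<phi>_def c_def proj_def herm_def
      by (simp add: of_real_def[symmetric])
  qed
  have "herm (\<phi> v) (\<phi> w) \<noteq> 0" if vw: "(v, w) \<in> set (steps (vs @ [hd vs]))" for v w
  proof
    assume 0: "herm (\<phi> v) (\<phi> w) = 0"
    have "v \<in> set vs" "w \<in> set vs" using set_steps[OF vw] hd_in_set[OF assms(1)] by auto
    then have *: "v \<noteq> 0" "w \<noteq> 0" using nz by blast+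
    consider "reg v" "reg w" | "reg v" "\<not> reg w" | "\<not> reg v" "reg w" | "\<not> reg v" "\<not> reg w" by blast
    then have "0 \<in> closed_segment v w"
    proof cases
      case 1
      then show ?thesis
        using 0 bracket_zero_imp_antipodal[of v w] unfolding \<phi>_def reg_def bracket_def by auto
    next
      case 2
      then have f: "fst v = 0" "fst w = 0" and "snd w \<le> 0"
        using 0 downward[of w] by (auto simp: \<phi>_def reg_def herm_def spinor_def)
      moreover have "snd v > 0"
        using 2(1) f unfolding reg_def by (auto simp: axial)
      ultimately have "w = - (- snd w / snd v) *\<^sub>R v" "- snd w / snd v \<ge> 0"
        by (auto simp: prod_eq_iff divide_simps)
      then show ?thesis by (rule zero_in_segment_antipodal)
    next
      case 3
      then have f: "fst v = 0" "fst w = 0" and "snd v \<le> 0"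
        using 0 downward[of v] by (auto simp: \<phi>_def reg_def herm_def spinor_def)
      moreover have "snd w > 0"
        using 3(2) f unfolding reg_def by (auto simp: axial)
      moreover have "snd v \<noteq> 0"
        using * f by (auto simp: prod_eq_iff)
      ultimately have "w = - (- snd w / snd v) *\<^sub>R v" "- snd w / snd v \<ge> 0"
        by (auto simp: prod_eq_iff divide_simps)
      then show ?thesis by (rule zero_in_segment_antipodal)
    next
      case 4
      then show ?thesis using 0 by (simp add: \<phi>_def herm_def)
    qed
    then show False using off vw by blast
  qed
  then have "(\<Prod>(v, w)\<leftarrow>steps (vs @ [hd vs]). herm (\<phi> v) (\<phi> w)) \<noteq> 0"
    by (auto simp: prod_list_zero_iff)
  then show ?thesis
    using holonomy_factor[OF assms(1), of "\<lambda>v. of_real (c v)" \<phi>] fac by auto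
qed

section \<open>Angles and crossings in the plane\<close>

lemma Arg_sign:
  assumes "Im z \<noteq> 0"
  shows "\<bar>Arg z\<bar> < pi" "0 < Arg z \<longleftrightarrow> 0 < Im z" "Arg z < 0 \<longleftrightarrow> Im z < 0"
proof -
  have "z \<noteq> 0" using assms by auto
  then have "norm z > 0" by simp
  moreover have "Im z = norm z * sin (Arg z)"
    by (metis Im_rcis rcis_cmod_Arg)
  ultimately have s: "sgn (sin (Arg z)) = sgn (Im z)" by (simp add: sgn_mult)
  have b: "- pi < Arg z" "Arg z \<le> pi" using Arg_bounded by auto
  have "Arg z \<noteq> pi" "Arg z \<noteq> 0" using s assms by (auto simp: sgn_zero_iff)
  then show "\<bar>Arg z\<bar> < pi" using b by auto
  have 1: "0 < Arg z \<Longrightarrow> 0 < Im z"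
    using s b \<open>Arg z \<noteq> pi\<close> sin_gt_zero[of "Arg z"] by (auto simp: sgn_if split: if_splits)
  have 2: "Arg z < 0 \<Longrightarrow> Im z < 0"
    using s b sin_gt_zero[of "- Arg z"] by (auto simp: sgn_if split: if_splits)
  show "0 < Arg z \<longleftrightarrow> 0 < Im z" "Arg z < 0 \<longleftrightarrow> Im z < 0"
    using 1 2 \<open>Arg z \<noteq> 0\<close> by linarith+
qed

lemma Arg_divide_same_side:
  assumes "Im z * Im w > 0"
  shows "Arg (z / w) = Arg z - Arg w"
proof (rule cis_Arg_unique)
  have nz: "Im z \<noteq> 0" "Im w \<noteq> 0" using assms by auto
  have "sgn (z / w) = cis (Arg z) / cis (Arg w)"
    using nz by (subst (1 2) cis_Arg) (auto simp: sgn_divide)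
  then show "sgn (z / w) = cis (Arg z - Arg w)" by (simp add: cis_divide)
  show "- pi < Arg z - Arg w" "Arg z - Arg w \<le> pi"
    using Arg_sign[OF nz(1)] Arg_sign[OF nz(2)] assms unfolding zero_less_mult_iff by linarith+
qed

text \<open>Twice the signed area of the triangle \<open>a b c\<close>.\<close>

definition ccw :: "complex \<Rightarrow> complex \<Rightarrow> complex \<Rightarrow> real" where
  "ccw a b c = Im (cnj (b - a) * (c - a))"

lemma ccw_cyclic: "ccw b c a = ccw a b c" "ccw c a b = ccw a b c"
  by (simp_all add: ccw_def algebra_simps)

lemma ccw_degenerate: "ccw a a b = 0" "ccw a b a = 0" "ccw b a a = 0"
  by (simp_all add: ccw_def algebra_simps)

lemma ccw_affine: "ccw a b ((1 - t) *\<^sub>R c + t *\<^sub>R d) = (1 - t) * ccw a b c + t * ccw a b d"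
  by (simp add: ccw_def algebra_simps)

definition crossing :: "complex \<Rightarrow> complex \<Rightarrow> complex \<Rightarrow> complex \<Rightarrow> bool" where
  "crossing a b c d \<longleftrightarrow> ccw a b c * ccw a b d < 0 \<and> ccw c d a * ccw c d b < 0"

definition angle_at :: "complex \<Rightarrow> complex \<Rightarrow> complex \<Rightarrow> real" where
  "angle_at x a b = Arg ((b - x) / (a - x))"

lemma Im_divide_sgn: "z \<noteq> 0 \<Longrightarrow> sgn (Im (w / z)) = sgn (Im (cnj z * w))"
  by (subst complex_div_cnj)
    (simp add: sgn_divide sgn_mult mult.commute flip: of_real_power)

lemma angle_at_sign:
  assumes "ccw x a b \<noteq> 0"
  shows "\<bar>angle_at x a b\<bar> < pi" "0 < angle_at x a b \<longleftrightarrow> 0 < ccw x a b"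
    "angle_at x a b < 0 \<longleftrightarrow> ccw x a b < 0"
proof -
  have "a - x \<noteq> 0" using assms by (auto simp: ccw_def)
  then have s: "sgn (Im ((b - x) / (a - x))) = sgn (ccw x a b)"
    unfolding ccw_def by (rule Im_divide_sgn)
  then have "Im ((b - x) / (a - x)) \<noteq> 0" using assms by (metis sgn_zero_iff)
  note * = Arg_sign[OF this]
  show "\<bar>angle_at x a b\<bar> < pi" "0 < angle_at x a b \<longleftrightarrow> 0 < ccw x a b"
    "angle_at x a b < 0 \<longleftrightarrow> ccw x a b < 0"
    using * s unfolding angle_at_def by (auto simp: sgn_if split: if_splits)
qed

text \<open>The interior angles of the quadrangle \<open>a c b d\<close>, with signs: they add up to a full turn exactly if its
  diagonals \<open>a b\<close> and \<open>c d\<close> cross.\<close>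

definition angle_defect :: "complex \<Rightarrow> complex \<Rightarrow> complex \<Rightarrow> complex \<Rightarrow> real" where
  "angle_defect a b c d = angle_at a c d - angle_at b c d - angle_at c a b + angle_at d a b"

lemma angle_defect_swap: "angle_defect c d a b = - angle_defect a b c d"
  by (simp add: angle_defect_def)

text \<open>If \<open>c\<close> and \<open>d\<close> lie on the same side of the line \<open>a b\<close>, all directions between the two pairs of points
  fill less than a half turn.  Every angle is then a difference of arguments, and these cancel.\<close>

lemma angle_defect_same_side:
  assumes "ccw a b c * ccw a b d > 0"
  shows "angle_defect a b c d = 0"
proof -
  define u where "u = b - a"
  have nz: "u \<noteq> 0" using assms by (auto simp: u_def ccw_def)
  have "ccw a b c = Im (cnj u * (c - a))" "ccw a b c = Im (cnj u * (c - b))"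
    "ccw a b d = Im (cnj u * (d - a))" "ccw a b d = Im (cnj u * (d - b))"
    by (simp_all add: ccw_def u_def algebra_simps)
  then have "sgn (Im ((c - a) / u)) = sgn (ccw a b c)" "sgn (Im ((c - b) / u)) = sgn (ccw a b c)"
    "sgn (Im ((d - a) / u)) = sgn (ccw a b d)" "sgn (Im ((d - b) / u)) = sgn (ccw a b d)"
    using Im_divide_sgn[OF nz] by metis+
  moreover have "sgn (ccw a b c) = sgn (ccw a b d)" "sgn (ccw a b c) * sgn (ccw a b c) = 1"
    using assms by (auto simp: sgn_if zero_less_mult_iff)
  ultimately have "sgn (Im z * Im w) = 1"
    if "z \<in> {(c - a) / u, (c - b) / u, (d - a) / u, (d - b) / u}"
      "w \<in> {(c - a) / u, (c - b) / u, (d - a) / u, (d - b) / u}" for z w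
    using that unfolding sgn_mult by auto
  then have pos: "Im z * Im w > 0"
    if "z \<in> {(c - a) / u, (c - b) / u, (d - a) / u, (d - b) / u}"
      "w \<in> {(c - a) / u, (c - b) / u, (d - a) / u, (d - b) / u}" for z w
    using that by (metis sgn_1_pos)
  have ratio: "Arg (z / w) = Arg (z / u) - Arg (w / u)"
    if "z \<in> {c - a, c - b, d - a, d - b}" "w \<in> {c - a, c - b, d - a, d - b}" for z w
  proof -
    have "Arg (z / w) = Arg ((z / u) / (w / u))" using nz by simp
    also have "\<dots> = Arg (z / u) - Arg (w / u)"
      by (rule Arg_divide_same_side, rule pos) (use that in auto)
    finally show ?thesis .
  qed
  have "(b - c) / (a - c) = (c - b) / (c - a)" "(b - d) / (a - d) = (d - b) / (d - a)"
    by (metis minus_diff_eq minus_divide_divide)+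
  then show ?thesis
    unfolding angle_defect_def angle_at_def using ratio by simp
qed

lemma angle_defect_integral:
  assumes "a \<noteq> c" "a \<noteq> d" "b \<noteq> c" "b \<noteq> d"
  shows "\<exists>k::int. angle_defect a b c d = 2 * pi * k"
proof -
  have cis: "cis (angle_at x y z) = sgn ((z - x) / (y - x))" if "y \<noteq> x" "z \<noteq> x" for x y z
    unfolding angle_at_def by (rule cis_Arg) (use that in auto)
  have "cis (angle_defect a b c d) = cis (angle_at a c d) / cis (angle_at b c d) / cis (angle_at c a b) * cis (angle_at d a b)"
    by (simp add: angle_defect_def cis_divide cis_mult)
  also have "\<dots> = sgn ((d - a) / (c - a) / ((d - b) / (c - b)) / ((b - c) / (a - c)) * ((b - d) / (a - d)))"
    using assms by (simp only: cis not_sym[OF assms(1)] not_sym[OF assms(2)] not_sym[OF assms(3)] not_sym[OF assms(4)]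
       not_False_eq_True sgn_divide sgn_mult)
  also have "(d - a) / (c - a) / ((d - b) / (c - b)) / ((b - c) / (a - c)) * ((b - d) / (a - d)) = 1"
    using assms by (simp add: divide_simps) (simp add: algebra_simps)
  finally have "exp (\<i> * of_real (angle_defect a b c d)) = 1"
    by (simp add: cis_conv_exp)
  then show ?thesis unfolding exp_eq_1 by (auto simp: mult_ac)
qed

text \<open>At a crossing the four signed angles have the same sign and are smaller than a half turn, so
  that their sum, a multiple of \<open>2 \<pi>\<close>, must be \<open>\<plusminus> 2 \<pi>\<close>.\<close>

lemma angle_defect_crossing:
  assumes "ccw a b c \<noteq> 0" "ccw a b d \<noteq> 0" "ccw c d a \<noteq> 0" "ccw c d b \<noteq> 0"
  shows "\<exists>k::int. angle_defect a b c d = 2 * pi * k \<and> (odd k \<longleftrightarrow> crossing a b c d)"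
proof (cases "crossing a b c d")
  case False
  then have "ccw a b c * ccw a b d > 0 \<or> ccw c d a * ccw c d b > 0"
    using assms unfolding crossing_def by (metis linorder_neqE_linordered_idom no_zero_divisors)
  then have "angle_defect a b c d = 0"
    using angle_defect_same_side angle_defect_swap by (metis neg_equal_0_iff_equal)
  then show ?thesis using False by (intro exI[of _ 0]) auto
next
  case True
  have ne: "a \<noteq> c" "a \<noteq> d" "b \<noteq> c" "b \<noteq> d"
    using assms ccw_degenerate by blast+
  obtain k :: int where k: "angle_defect a b c d = 2 * pi * k"
    using angle_defect_integral[OF ne] by blast
  have sum: "ccw c d b - ccw c d a + ccw a b d - ccw a b c = 0"
    by (simp add: ccw_def algebra_simps)
  have cyc: "ccw a c d = ccw c d a" "ccw b c d = ccw c d b" "ccw c a b = ccw a b c" "ccw d a b = ccw a b d"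
    by (simp_all add: ccw_cyclic)
  have "\<bar>angle_defect a b c d\<bar> < 2 * pi * 2 \<and> angle_defect a b c d \<noteq> 0"
  proof (cases "ccw c d a > 0")
    case True
    then have "ccw a c d > 0" "ccw b c d < 0" "ccw c a b < 0" "ccw d a b > 0"
      using \<open>crossing a b c d\<close> sum unfolding crossing_def mult_less_0_iff cyc by linarith+
    then show ?thesis
      using angle_at_sign[of a c d] angle_at_sign[of b c d] angle_at_sign[of c a b] angle_at_sign[of d a b]
      unfolding angle_defect_def by simp
  next
    case False
    then have "ccw a c d < 0" "ccw b c d > 0" "ccw c a b > 0" "ccw d a b < 0"
      using \<open>crossing a b c d\<close> sum unfolding crossing_def mult_less_0_iff cyc by linarith+
    then show ?thesis
      using angle_at_sign[of a c d] angle_at_sign[of b c d] angle_at_sign[of c a b] angle_at_sign[of d a b]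
      unfolding angle_defect_def by simp
  qed
  then have "\<bar>k\<bar> < 2 \<and> k \<noteq> 0"
    unfolding k by (auto simp: abs_mult)
  then have "odd k" by presburger
  then show ?thesis using k True by blast
qed

section \<open>One segment passing over another\<close>

text \<open>The contribution of the edge from \<open>a\<close> to \<open>b\<close> to the holonomy seen from \<open>x\<close>.  It vanishes on the edge and
  above its ends, and it is negative exactly above the interior of the edge.\<close>

definition view :: "space \<Rightarrow> space \<Rightarrow> space \<Rightarrow> complex" where
  "view a b x = bracket (a - x) (b - x)"

text \<open>The segment \<open>t\<close> passes over \<open>s\<close>.  Stated through the sign of \<open>view\<close>, this is what changes the
  argument of the holonomy by a full turn; \<open>over_iff_below\<close> compares heights.\<close>

definition over :: "space \<times> space \<Rightarrow> space \<times> space \<Rightarrow> bool" where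
  "over s t \<longleftrightarrow> (\<exists>x \<in> closed_segment (fst t) (snd t).
     Im (view (fst s) (snd s) x) = 0 \<and> Re (view (fst s) (snd s) x) < 0)"

lemma Im_view: "Im (view a b x) = ccw (fst a) (fst b) (fst x)"
  by (simp add: view_def bracket_def herm_def spinor_def ccw_def algebra_simps)

lemma Im_view_affine:
  "Im (view a b ((1 - t) *\<^sub>R c + t *\<^sub>R d)) = (1 - t) * Im (view a b c) + t * Im (view a b d)"
  by (simp add: Im_view ccw_affine)

lemma Re_view: "Re (view a b x) = (norm (a - x) + snd (a - x)) * (norm (b - x) + snd (b - x))
    + Re (cnj (fst (a - x)) * fst (b - x))"
  by (simp add: view_def bracket_def herm_def spinor_def)

lemma continuous_on_view: "continuous_on A (view a b)"
  unfolding view_def bracket_def herm_def spinor_def by (auto intro!: continuous_intros)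

text \<open>The imaginary part of \<open>view\<close> is affine along a segment, because it only depends on the
  signed area in the projection.\<close>

lemma Im_view_zero_unique:
  assumes "Im (view a b c) \<noteq> 0" "x \<in> closed_segment c d" "y \<in> closed_segment c d"
    and "Im (view a b x) = 0" "Im (view a b y) = 0"
  shows "x = y"
proof -
  obtain t s where ts: "x = (1 - t) *\<^sub>R c + t *\<^sub>R d" "y = (1 - s) *\<^sub>R c + s *\<^sub>R d"
    using assms(2,3) unfolding in_segment by blast
  define C where "C = Im (view a b c)"
  define D where "D = Im (view a b d)"
  have "(1 - t) * C + t * D = 0" "(1 - s) * C + s * D = 0"
    using assms(4,5) unfolding ts Im_view_affine C_def D_def by auto
  then have "C + t * (D - C) = 0" "C + s * (D - C) = 0" by (simp_all add: algebra_simps)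
  moreover from this have "D - C \<noteq> 0" using assms(1) unfolding C_def by auto
  ultimately have "t = s" by (metis add_left_cancel mult_right_cancel)
  then show ?thesis using ts by simp
qed

lemma view_nonzero:
  assumes "fst a \<noteq> fst x" "fst b \<noteq> fst x" "x \<notin> closed_segment a b"
  shows "view a b x \<noteq> 0"
proof
  assume "view a b x = 0"
  moreover have "norm (a - x) + snd (a - x) \<noteq> 0" "norm (b - x) + snd (b - x) \<noteq> 0"
    using downward[of "a - x"] downward[of "b - x"] assms by auto
  ultimately have "0 \<in> closed_segment (a - x) (b - x)"
    unfolding view_def by (intro bracket_zero_imp_antipodal)
  then have "x + 0 \<in> (+) x ` closed_segment (a - x) (b - x)" by blast
  also have "\<dots> = closed_segment a b"
    by (simp flip: closed_segment_translation)
  finally show False using assms by simp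
qed

text \<open>Along the segment from \<open>c\<close> to \<open>d\<close> the imaginary part of \<open>view a b\<close> is affine and changes sign at most once.  So
  \<open>view a b\<close> meets the negative real axis once, if \<open>c d\<close> passes over \<open>a b\<close>, or not at all; only in the
  first case does a continuous argument differ from the principal one by a full turn.\<close>

lemma view_logarithm:
  assumes C: "Im (view a b c) \<noteq> 0" and D: "Im (view a b d) \<noteq> 0"
    and nz: "\<And>x. x \<in> closed_segment c d \<Longrightarrow> view a b x \<noteq> 0"
  shows "\<exists>l. continuous_on (closed_segment c d) l \<and> (\<forall>x \<in> closed_segment c d. exp (l x) = view a b x) \<and>
     (\<exists>k::int. Im (l d) - Im (l c) = Arg (view a b d) - Arg (view a b c) + 2 * pi * k \<and>
       (odd k \<longleftrightarrow> over (a, b) (c, d)))"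
proof (cases "over (a, b) (c, d)")
  case False
  have slit: "view a b x \<notin> \<real>\<^sub>\<le>\<^sub>0" if x: "x \<in> closed_segment c d" for x
  proof
    assume "view a b x \<in> \<real>\<^sub>\<le>\<^sub>0"
    then have "Im (view a b x) = 0" "Re (view a b x) \<le> 0"
      by (auto simp: complex_nonpos_Reals_iff)
    moreover from this have "Re (view a b x) \<noteq> 0" using nz[OF x] by (auto simp: complex_eq_iff)
    ultimately show False using False x by (force simp: over_def)
  qed
  show ?thesis
  proof (intro exI conjI ballI)
    show "continuous_on (closed_segment c d) (\<lambda>x. Ln (view a b x))"
      using slit by (intro continuous_intros continuous_on_view) auto
    show "exp (Ln (view a b x)) = view a b x" if "x \<in> closed_segment c d" for x
      using nz[OF that] by simp
    show "Im (Ln (view a b d)) - Im (Ln (view a b c)) = Arg (view a b d) - Arg (view a b c) + 2 * pi * of_int 0"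
      using nz by (simp add: Arg_eq_Im_Ln)
    show "odd (0::int) \<longleftrightarrow> over (a, b) (c, d)" using False by simp
  qed
next
  case True
  then obtain x0 where x0: "x0 \<in> closed_segment c d" "Im (view a b x0) = 0" "Re (view a b x0) < 0"
    by (auto simp: over_def)
  \<comment> \<open>The view is real only at \<open>x0\<close>, where it is negative; so it avoids the positive real axis.\<close>
  have slit: "- view a b x \<notin> \<real>\<^sub>\<le>\<^sub>0" if x: "x \<in> closed_segment c d" for x
  proof
    assume "- view a b x \<in> \<real>\<^sub>\<le>\<^sub>0"
    then have "Im (view a b x) = 0" "Re (view a b x) \<ge> 0"
      by (auto simp: complex_nonpos_Reals_iff)
    then show False using Im_view_zero_unique[OF C x x0(1)] x0 by auto
  qed
  have opp: "Im (view a b c) > 0 \<longleftrightarrow> Im (view a b d) < 0"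
  proof -
    obtain t where t: "x0 = (1 - t) *\<^sub>R c + t *\<^sub>R d" "0 \<le> t" "t \<le> 1"
      using x0(1) unfolding in_segment by blast
    have e: "(1 - t) * Im (view a b c) + t * Im (view a b d) = 0"
      using x0(2) unfolding t(1) Im_view_affine .
    have "t \<noteq> 0" "t \<noteq> 1" using e C D by auto
    then have "t > 0" "1 - t > 0" using t by auto
    then show ?thesis
      using e C D by (metis add.inverse_inverse add_eq_0_iff less_minus_iff linorder_neqE_linordered_idom
          mult_pos_pos mult_pos_neg neg_less_0_iff_less less_asym minus_zero zero_less_mult_pos)
  qed
  have Argm: "Arg (- z) = (if Im z < 0 then Arg z + pi else Arg z - pi)" if "Im z \<noteq> 0" for z
  proof -
    have "z \<noteq> 0" using that by auto
    then show ?thesis using Arg_minus[of z] Arg_sign[OF that] that by auto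
  qed
  show ?thesis
  proof (intro exI conjI ballI)
    show "continuous_on (closed_segment c d) (\<lambda>x. Ln (- view a b x) + \<i> * pi)"
      using slit by (intro continuous_intros continuous_on_view) auto
    show "exp (Ln (- view a b x) + \<i> * pi) = view a b x" if "x \<in> closed_segment c d" for x
      using nz[OF that] by (simp add: exp_add)
    have "c \<in> closed_segment c d" "d \<in> closed_segment c d" by simp_all
    then have "- view a b c \<noteq> 0" "- view a b d \<noteq> 0" using nz by auto
    then have "Im (Ln (- view a b d) + \<i> * pi) - Im (Ln (- view a b c) + \<i> * pi) =
        Arg (- view a b d) - Arg (- view a b c)"
      using Arg_eq_Im_Ln by simp
    also have "\<dots> = Arg (view a b d) - Arg (view a b c)
        + 2 * pi * of_int (if Im (view a b c) > 0 then 1 else - 1)"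
      using opp C D Argm by auto
    finally show "Im (Ln (- view a b d) + \<i> * pi) - Im (Ln (- view a b c) + \<i> * pi) =
        Arg (view a b d) - Arg (view a b c) + 2 * pi * of_int (if Im (view a b c) > 0 then 1 else - 1)" .
    show "odd (if Im (view a b c) > 0 then 1 else - 1 :: int) \<longleftrightarrow> over (a, b) (c, d)" using True by simp
  qed
qed

text \<open>The numbers \<open>A = (norm v + snd v) / s\<close> and \<open>A' = (norm v - snd v) / s\<close> have product \<open>|u|\<^sup>2\<close>, and
  likewise \<open>B\<close> and \<open>B'\<close> for \<open>w\<close> and \<open>1 - s\<close>.  Hence \<open>A B - |u|\<^sup>2\<close> has the sign of \<open>A - A' + B - B'\<close>.  Up to positive
  factors the former is the real part of the bracket and the latter the height at which the segment
  from \<open>v\<close> to \<open>w\<close> meets the vertical axis.\<close>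

lemma Re_bracket_sign:
  assumes s: "0 < s" "s < 1" and u: "u \<noteq> 0" and "fst v = - (s *\<^sub>R u)" "fst w = (1 - s) *\<^sub>R u"
  shows "Re (bracket v w) < 0 \<longleftrightarrow> (1 - s) * snd v + s * snd w < 0"
proof -
  define r where "r = (norm u)\<^sup>2"
  define A where "A = (norm v + snd v) / s"
  define B where "B = (norm w + snd w) / (1 - s)"
  define A' where "A' = (norm v - snd v) / s"
  define B' where "B' = (norm w - snd w) / (1 - s)"
  have AA: "A * A' = r" "B * B' = r"
  proof -
    have n: "norm (fst v) = s * norm u" "norm (fst w) = (1 - s) * norm u"
      using s unfolding assms(4,5) by simp_all
    have "A * A' = (norm (fst v))\<^sup>2 / s\<^sup>2" "B * B' = (norm (fst w))\<^sup>2 / (1 - s)\<^sup>2"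
      unfolding A_def A'_def B_def B'_def norm_space[symmetric] by (simp_all add: power2_eq_square)
    then show "A * A' = r" "B * B' = r"
      using s unfolding n r_def by (simp_all add: power_mult_distrib)
  qed
  have "r > 0" using u by (simp add: r_def)
  have "A \<ge> 0" "B \<ge> 0" using norm_space_nonneg s by (auto simp: A_def B_def)
  then have pos: "A > 0" "B > 0" using AA \<open>r > 0\<close> by (auto simp: less_le)
  have "cnj (fst v) * fst w = of_real (- (s * (1 - s)) * r)"
    unfolding assms(4,5) r_def by (simp add: scaleR_conv_of_real complex_norm_square del: of_real_power)
  moreover have "norm v + snd v = s * A" "norm w + snd w = (1 - s) * B"
    using s by (auto simp: A_def B_def)
  moreover have "Re (bracket v w) = (norm v + snd v) * (norm w + snd w) + Re (cnj (fst v) * fst w)"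
    by (simp add: bracket_def herm_def spinor_def)
  ultimately have "Re (bracket v w) = (s * A) * ((1 - s) * B) + - (s * (1 - s)) * r"
    by (simp only: Re_complex_of_real)
  then have Re: "Re (bracket v w) = s * (1 - s) * (A * B - r)"
    by (simp add: algebra_simps)
  have "2 * snd v = s * (A - A')" "2 * snd w = (1 - s) * (B - B')"
    using s unfolding right_diff_distrib by (simp_all add: A_def A'_def B_def B'_def)
  moreover have "2 * ((1 - s) * snd v + s * snd w) = (1 - s) * (2 * snd v) + s * (2 * snd w)"
    by (simp add: algebra_simps)
  ultimately have "2 * ((1 - s) * snd v + s * snd w) = s * (1 - s) * (A - A' + (B - B'))"
    by (simp only:) (simp add: algebra_simps)
  then have "(2 * ((1 - s) * snd v + s * snd w)) * (A * B) = (s * (1 - s) * (A - A' + (B - B'))) * (A * B)"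
    by (rule arg_cong)
  also have "\<dots> = s * (1 - s) * (A * B * (A + B) - (A * A') * B - A * (B * B'))"
    by (simp add: algebra_simps)
  also have "\<dots> = (A + B) * Re (bracket v w)"
    unfolding Re AA by (simp add: algebra_simps)
  finally have *: "((1 - s) * snd v + s * snd w) * (2 * (A * B)) = Re (bracket v w) * (A + B)"
    by (simp add: algebra_simps)
  have "2 * (A * B) > 0" "A + B > 0" using pos by auto
  then show ?thesis
    using * by (metis mult_less_0_iff less_asym)
qed

lemma over_imp_crossing:
  assumes "ccw (fst a) (fst b) (fst c) \<noteq> 0" "ccw (fst a) (fst b) (fst d) \<noteq> 0"
    "ccw (fst c) (fst d) (fst a) \<noteq> 0" "ccw (fst c) (fst d) (fst b) \<noteq> 0"
    and "over (a, b) (c, d)"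
  shows "crossing (fst a) (fst b) (fst c) (fst d)"
proof -
  obtain x where x: "x \<in> closed_segment c d" "Im (view a b x) = 0" "Re (view a b x) < 0"
    using assms(5) by (auto simp: over_def)
  obtain t where t: "x = (1 - t) *\<^sub>R c + t *\<^sub>R d" "0 \<le> t" "t \<le> 1"
    using x(1) unfolding in_segment by blast
  have e: "(1 - t) * ccw (fst a) (fst b) (fst c) + t * ccw (fst a) (fst b) (fst d) = 0"
    using x(2) unfolding t(1) Im_view_affine by (simp add: Im_view)
  have "t \<noteq> 0" "t \<noteq> 1" using e assms by auto
  then have "t > 0" "1 - t > 0" using t by auto
  define p where "p = fst (a - x)"
  define q where "q = fst (b - x)"
  define r where "r = - Re (cnj p * q)"
  have "(norm (a - x) + snd (a - x)) * (norm (b - x) + snd (b - x)) \<ge> 0"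
    by (intro mult_nonneg_nonneg norm_space_nonneg)
  then have "r > 0"
    using x(3) unfolding Re_view r_def p_def q_def by linarith
  have "cnj p * q = - of_real r"
    using x(2) unfolding r_def p_def q_def by (auto simp: complex_eq_iff view_def bracket_def herm_def spinor_def)
  have v: "ccw (fst c) (fst d) (fst a) = Im (cnj (fst d - fst c) * p)"
    "ccw (fst c) (fst d) (fst b) = Im (cnj (fst d - fst c) * q)"
    unfolding p_def q_def t(1) ccw_def by (simp_all add: algebra_simps)
  have "(norm p)\<^sup>2 * Im (cnj (fst d - fst c) * q) = Im (cnj (fst d - fst c) * (of_real ((norm p)\<^sup>2) * q))"
    by (simp add: algebra_simps del: of_real_power)
  also have "of_real ((norm p)\<^sup>2) * q = p * (cnj p * q)"
    by (simp add: complex_norm_square mult.assoc del: of_real_power)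
  also have "\<dots> = - (of_real r * p)"
    unfolding \<open>cnj p * q = - of_real r\<close> by simp
  also have "Im (cnj (fst d - fst c) * - (of_real r * p)) = - r * Im (cnj (fst d - fst c) * p)"
    by (simp add: algebra_simps)
  finally have *: "(norm p)\<^sup>2 * ccw (fst c) (fst d) (fst b) = - r * ccw (fst c) (fst d) (fst a)"
    unfolding v .
  have "p \<noteq> 0" using \<open>cnj p * q = - of_real r\<close> \<open>r > 0\<close> by auto
  then have n: "(norm p)\<^sup>2 > 0" by simp
  have gen: "A * B < 0" if "l * A = - m * B" "l > 0" "m > 0" "B \<noteq> 0" for l m A B :: real
  proof -
    have "l * (A * B) = (l * A) * B" by simp
    also have "\<dots> = - m * (B * B)" unfolding that(1) by simp
    also have "\<dots> < 0" using that by (auto simp: zero_less_mult_iff linorder_neq_iff)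
    finally show ?thesis using that(2) by (simp add: mult_less_0_iff)
  qed
  have "ccw (fst c) (fst d) (fst b) * ccw (fst c) (fst d) (fst a) < 0"
    using gen[OF * n \<open>r > 0\<close>] assms(3) by blast
  moreover have "ccw (fst a) (fst b) (fst c) * ccw (fst a) (fst b) (fst d) < 0"
    by (rule gen[of "1 - t" _ t]) (use e assms(2) \<open>t > 0\<close> \<open>1 - t > 0\<close> in auto)
  ultimately show ?thesis by (simp add: crossing_def mult.commute)
qed

lemma over_iff_below:
  assumes "ccw (fst a) (fst b) (fst c) \<noteq> 0" and x: "x \<in> closed_segment c d" "fst y = fst x"
    and y: "y = (1 - s) *\<^sub>R a + s *\<^sub>R b" "0 < s" "s < 1"
  shows "over (a, b) (c, d) \<longleftrightarrow> snd y < snd x"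
proof -
  define u where "u = fst b - fst a"
  have u: "u \<noteq> 0" using assms(1) by (auto simp: u_def ccw_def)
  have ax: "fst (a - x) = - (s *\<^sub>R u)" "fst (b - x) = (1 - s) *\<^sub>R u"
    using x(2) unfolding u_def y(1) by (auto simp: algebra_simps)
  have "Re (view a b x) < 0 \<longleftrightarrow> (1 - s) * snd (a - x) + s * snd (b - x) < 0"
    unfolding view_def by (rule Re_bracket_sign[OF y(2,3) u ax])
  also have "(1 - s) * snd (a - x) + s * snd (b - x) = snd y - snd x"
    unfolding y(1) by (simp add: algebra_simps)
  finally have Re: "Re (view a b x) < 0 \<longleftrightarrow> snd y < snd x" by simp
  have Im: "Im (view a b x) = 0"
    unfolding view_def bracket_def herm_def spinor_def using ax by simp
  have "over (a, b) (c, d) \<longleftrightarrow> Re (view a b x) < 0"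
  proof
    assume "over (a, b) (c, d)"
    then obtain x' where x': "x' \<in> closed_segment c d" "Im (view a b x') = 0" "Re (view a b x') < 0"
      by (auto simp: over_def)
    have "Im (view a b c) \<noteq> 0" using assms(1) by (simp add: Im_view)
    then have "x' = x" using Im_view_zero_unique x'(1,2) x(1) Im by blast
    then show "Re (view a b x) < 0" using x'(3) by simp
  next
    assume "Re (view a b x) < 0"
    then show "over (a, b) (c, d)" unfolding over_def using x(1) Im by auto
  qed
  then show ?thesis using Re by simp
qed

lemma affine_zero_between:
  fixes A B :: real
  assumes "A * B < 0"
  shows "\<exists>t. 0 < t \<and> t < 1 \<and> (1 - t) * A + t * B = 0"
proof (intro exI conjI)
  have "A \<noteq> B" using assms by (metis not_square_less_zero)
  then show "(1 - A / (A - B)) * A + A / (A - B) * B = 0" by (simp add: field_simps)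
  show "0 < A / (A - B)" "A / (A - B) < 1"
    using assms by (auto simp: mult_less_0_iff divide_simps)
qed

text \<open>Segments that cross in projection and are disjoint in space have different heights at the
  crossing, so exactly one of them passes over the other.\<close>

lemma crossing_iff_over_flip:
  assumes nz: "ccw (fst a) (fst b) (fst c) \<noteq> 0" "ccw (fst a) (fst b) (fst d) \<noteq> 0"
    "ccw (fst c) (fst d) (fst a) \<noteq> 0" "ccw (fst c) (fst d) (fst b) \<noteq> 0"
    and disj: "closed_segment a b \<inter> closed_segment c d = {}"
  shows "crossing (fst a) (fst b) (fst c) (fst d) \<longleftrightarrow> over (a, b) (c, d) \<noteq> over (c, d) (a, b)"
proof (cases "crossing (fst a) (fst b) (fst c) (fst d)")
  case False
  then have "\<not> crossing (fst c) (fst d) (fst a) (fst b)" by (auto simp: crossing_def)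
  then show ?thesis using False over_imp_crossing nz by blast
next
  case True
  obtain t where t: "0 < t" "t < 1" "(1 - t) * ccw (fst a) (fst b) (fst c) + t * ccw (fst a) (fst b) (fst d) = 0"
    using True affine_zero_between unfolding crossing_def by blast
  obtain s where s: "0 < s" "s < 1" "(1 - s) * ccw (fst c) (fst d) (fst a) + s * ccw (fst c) (fst d) (fst b) = 0"
    using True affine_zero_between unfolding crossing_def by blast
  define x where "x = (1 - t) *\<^sub>R c + t *\<^sub>R d"
  define y where "y = (1 - s) *\<^sub>R a + s *\<^sub>R b"
  have x: "x \<in> closed_segment c d" and y: "y \<in> closed_segment a b"
    unfolding x_def y_def in_segment using s t by (auto intro: less_imp_le)
  have on_line: "ccw (fst a) (fst b) (fst x) = 0" "ccw (fst c) (fst d) (fst y) = 0"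
    "ccw (fst a) (fst b) (fst y) = 0" "ccw (fst c) (fst d) (fst x) = 0"
    using s(3) t(3) by (simp_all add: x_def y_def ccw_affine ccw_degenerate)
  have diff: "Im (cnj (q - p) * (z - w)) = ccw p q z - ccw p q w" for p q z w
    by (simp add: ccw_def algebra_simps)
  have perp: "Im (cnj (fst b - fst a) * (fst x - fst y)) = 0" "Im (cnj (fst d - fst c) * (fst x - fst y)) = 0"
    unfolding diff on_line by simp_all
  have ne: "Im (cnj (fst b - fst a) * (fst d - fst c)) \<noteq> 0"
  proof -
    have "Im (cnj (fst b - fst a) * (fst d - fst c)) = ccw (fst a) (fst b) (fst d) - ccw (fst a) (fst b) (fst c)"
      by (simp add: ccw_def algebra_simps)
    then show ?thesis using True unfolding crossing_def by (auto simp: mult_less_0_iff)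
  qed
  have "p = 0" if "Im (cnj u * p) = 0" "Im (cnj v * p) = 0" "Im (cnj u * v) \<noteq> 0" for u v p
  proof -
    have "Im (cnj u * v) * Re p = Re v * Im (cnj u * p) - Re u * Im (cnj v * p)"
      "Im (cnj u * v) * Im p = Im v * Im (cnj u * p) - Im u * Im (cnj v * p)"
      by (simp_all add: algebra_simps)
    then have "Im (cnj u * v) * Re p = 0" "Im (cnj u * v) * Im p = 0"
      unfolding that(1,2) by simp_all
    then show ?thesis using that(3) by (simp add: complex_eq_iff)
  qed
  from this[OF perp ne] have xy: "fst x = fst y" by simp
  have "x \<noteq> y" using x y disj by blast
  then have "snd x \<noteq> snd y" using xy by (auto simp: prod_eq_iff)
  moreover have "over (a, b) (c, d) \<longleftrightarrow> snd y < snd x"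
    by (rule over_iff_below[OF nz(1) x xy[symmetric] y_def s(1,2)])
  moreover have "over (c, d) (a, b) \<longleftrightarrow> snd x < snd y"
    by (rule over_iff_below[OF nz(3) y xy x_def t(1,2)])
  ultimately show ?thesis using True by auto
qed

section \<open>Overcrossings of logarithmically separated polygons\<close>

definition general_position :: "space set \<Rightarrow> bool" where
  "general_position P \<longleftrightarrow>
     (\<forall>a\<in>P. \<forall>b\<in>P. \<forall>c\<in>P. distinct [a, b, c] \<longrightarrow> ccw (fst a) (fst b) (fst c) \<noteq> 0)"

lemma general_position_subset: "general_position P \<Longrightarrow> Q \<subseteq> P \<Longrightarrow> general_position Q"
  unfolding general_position_def by (meson subsetD)

definition overcrossings :: "space list \<Rightarrow> space list \<Rightarrow> int" where
  "overcrossings xs ys = (\<Sum>s\<leftarrow>steps xs. \<Sum>t\<leftarrow>steps ys. of_bool (over s t))"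

lemma even_sum_list_cong:
  fixes f g :: "'a \<Rightarrow> int"
  assumes "\<And>x. x \<in> set xs \<Longrightarrow> odd (f x) \<longleftrightarrow> odd (g x)"
  shows "even (\<Sum>x\<leftarrow>xs. f x) \<longleftrightarrow> even (\<Sum>x\<leftarrow>xs. g x)"
  using assms by (induction xs) auto

lemma sum_list_swap:
  fixes f :: "'a \<Rightarrow> 'b \<Rightarrow> 'c::comm_monoid_add"
  shows "(\<Sum>x\<leftarrow>xs. \<Sum>y\<leftarrow>ys. f x y) = (\<Sum>y\<leftarrow>ys. \<Sum>x\<leftarrow>xs. f x y)"
  by (induction xs) (simp_all add: sum_list_addf)

text \<open>Adding the logarithms of the single edges turns the full turns of \<open>view_logarithm\<close> into a
  count of overcrossings.\<close>

lemma views_logarithm: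
  assumes "\<And>s. s \<in> set ss \<Longrightarrow> Im (view (fst s) (snd s) c) \<noteq> 0 \<and> Im (view (fst s) (snd s) d) \<noteq> 0"
    and "\<And>s x. s \<in> set ss \<Longrightarrow> x \<in> closed_segment c d \<Longrightarrow> view (fst s) (snd s) x \<noteq> 0"
  shows "\<exists>l. continuous_on (closed_segment c d) l \<and>
     (\<forall>x \<in> closed_segment c d. exp (l x) = (\<Prod>(a, b)\<leftarrow>ss. view a b x)) \<and>
     (\<exists>k::int. Im (l d) - Im (l c) = (\<Sum>(a, b)\<leftarrow>ss. Arg (view a b d)) - (\<Sum>(a, b)\<leftarrow>ss. Arg (view a b c)) + 2 * pi * k \<and>
       (odd k \<longleftrightarrow> odd (\<Sum>s\<leftarrow>ss. of_bool (over s (c, d)) :: int)))"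
  using assms
proof (induction ss)
  case Nil
  show ?case by (intro exI[of _ "\<lambda>_. 0"] conjI exI[of _ 0]) auto
next
  case (Cons s ss)
  obtain a b where s: "s = (a, b)" by (cases s)
  obtain l k where l: "continuous_on (closed_segment c d) l"
    "\<And>x. x \<in> closed_segment c d \<Longrightarrow> exp (l x) = (\<Prod>(a, b)\<leftarrow>ss. view a b x)"
    "Im (l d) - Im (l c) = (\<Sum>(a, b)\<leftarrow>ss. Arg (view a b d)) - (\<Sum>(a, b)\<leftarrow>ss. Arg (view a b c)) + 2 * pi * of_int k"
    "odd k \<longleftrightarrow> odd (\<Sum>s\<leftarrow>ss. of_bool (over s (c, d)) :: int)"
    using Cons.IH Cons.prems by (auto simp: ball_Un)
  have "Im (view a b c) \<noteq> 0" "Im (view a b d) \<noteq> 0"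
    "\<And>x. x \<in> closed_segment c d \<Longrightarrow> view a b x \<noteq> 0"
    using Cons.prems[of s] by (auto simp: s)
  then obtain m j where m: "continuous_on (closed_segment c d) m"
    "\<And>x. x \<in> closed_segment c d \<Longrightarrow> exp (m x) = view a b x"
    "Im (m d) - Im (m c) = Arg (view a b d) - Arg (view a b c) + 2 * pi * of_int j"
    "odd j \<longleftrightarrow> over (a, b) (c, d)"
    using view_logarithm[of a b c d] by blast
  show ?case
  proof (intro exI conjI ballI)
    show "continuous_on (closed_segment c d) (\<lambda>x. m x + l x)"
      using l(1) m(1) by (rule continuous_on_add[rotated])
    show "exp (m x + l x) = (\<Prod>(a, b)\<leftarrow>s # ss. view a b x)" if "x \<in> closed_segment c d" for x
      using l(2)[OF that] m(2)[OF that] by (simp add: s exp_add)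
    show "Im (m d + l d) - Im (m c + l c) = (\<Sum>(a, b)\<leftarrow>s # ss. Arg (view a b d)) -
        (\<Sum>(a, b)\<leftarrow>s # ss. Arg (view a b c)) + 2 * pi * of_int (j + k)"
      using l(3) m(3) by (simp add: s algebra_simps)
    show "odd (j + k) \<longleftrightarrow> odd (\<Sum>s\<leftarrow>s # ss. of_bool (over s (c, d)) :: int)"
      using l(4) m(4) by (cases "over (a, b) (c, d)") (auto simp: s)
  qed
qed

lemma exp_positive_imp_Im:
  assumes "exp z = of_real r" "r > 0"
  shows "\<exists>n::int. Im z = 2 * pi * n"
proof -
  have "exp (z - of_real (ln r)) = 1"
    using assms by (simp add: exp_diff exp_of_real)
  then show ?thesis unfolding exp_eq_1 by (auto simp: mult_ac)
qed

text \<open>Up to a positive factor the holonomy is the product of the views of the edges, so its logarithm changes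
  like the sum of theirs.\<close>

lemma holonomy_change_along_segment:
  assumes "vs \<noteq> []"
    and nz: "\<And>s. s \<in> set (steps (vs @ [hd vs])) \<Longrightarrow> Im (view (fst s) (snd s) c) \<noteq> 0 \<and> Im (view (fst s) (snd s) d) \<noteq> 0"
    and view: "\<And>s x. s \<in> set (steps (vs @ [hd vs])) \<Longrightarrow> x \<in> closed_segment c d \<Longrightarrow> view (fst s) (snd s) x \<noteq> 0"
    and vert: "\<And>v x. v \<in> set vs \<Longrightarrow> x \<in> closed_segment c d \<Longrightarrow> fst v \<noteq> fst x"
    and l: "continuous_on (closed_segment c d) l"
      "\<And>x. x \<in> closed_segment c d \<Longrightarrow> holonomy (map (\<lambda>v. v - x) vs) = exp (l x)"
  shows "\<exists>k::int. Im (l d) - Im (l c) = (\<Sum>(a, b)\<leftarrow>steps (vs @ [hd vs]). Arg (view a b d))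
        - (\<Sum>(a, b)\<leftarrow>steps (vs @ [hd vs]). Arg (view a b c)) + 2 * pi * k \<and>
     (odd k \<longleftrightarrow> odd (\<Sum>s\<leftarrow>steps (vs @ [hd vs]). of_bool (over s (c, d)) :: int))"
proof -
  let ?ss = "steps (vs @ [hd vs])"
  obtain m k where m: "continuous_on (closed_segment c d) m"
    "\<And>x. x \<in> closed_segment c d \<Longrightarrow> exp (m x) = (\<Prod>(a, b)\<leftarrow>?ss. view a b x)"
    "Im (m d) - Im (m c) = (\<Sum>(a, b)\<leftarrow>?ss. Arg (view a b d)) - (\<Sum>(a, b)\<leftarrow>?ss. Arg (view a b c)) + 2 * pi * of_int k"
    "odd k \<longleftrightarrow> odd (\<Sum>s\<leftarrow>?ss. of_bool (over s (c, d)) :: int)"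
    using views_logarithm[of ?ss c d, OF nz view] by blast
  \<comment> \<open>The two logarithms differ by a function with imaginary part in \<open>2 \<pi> \<int>\<close>, hence constant.\<close>
  define f where "f = (\<lambda>x. Im (m x) - Im (l x))"
  have int: "\<exists>n::int. f x = 2 * pi * n" if x: "x \<in> closed_segment c d" for x
  proof -
    define R where "R = (\<Prod>v\<leftarrow>map (\<lambda>v. v - x) vs. norm v + snd v)"
    have "norm (v - x) + snd (v - x) > 0" if "v \<in> set vs" for v
      using norm_space_nonneg(1)[of "v - x"] downward[of "v - x"] vert[OF that x] by force
    then have "R > 0" unfolding R_def by (induction vs) auto
    have "map (\<lambda>v. v - x) vs \<noteq> []" using assms(1) by simp
    note holonomy_eq_bracket[OF this]
    also have "map (\<lambda>v. v - x) vs @ [hd (map (\<lambda>v. v - x) vs)] = map (\<lambda>v. v - x) (vs @ [hd vs])"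
      using assms(1) by (simp add: hd_map)
    also have "(\<Prod>(v, w)\<leftarrow>steps (map (\<lambda>v. v - x) (vs @ [hd vs])). bracket v w) = (\<Prod>(a, b)\<leftarrow>?ss. view a b x)"
      by (simp only: steps_map) (simp add: view_def comp_def case_prod_unfold)
    finally have "of_real R * exp (l x) = exp (m x)"
      using l(2)[OF x] m(2)[OF x] by (simp add: R_def)
    then have "exp (m x - l x) = of_real R" by (simp add: exp_diff divide_simps)
    then show ?thesis using exp_positive_imp_Im[of "m x - l x", OF _ \<open>R > 0\<close>] by (simp add: f_def)
  qed
  have "f constant_on closed_segment c d"
  proof (rule continuous_discrete_range_constant)
    show "continuous_on (closed_segment c d) f"
      unfolding f_def using l(1) m(1) by (intro continuous_intros)
    fix x assume x: "x \<in> closed_segment c d"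
    show "\<exists>e>0. \<forall>y. y \<in> closed_segment c d \<and> f y \<noteq> f x \<longrightarrow> e \<le> norm (f y - f x)"
    proof (intro exI[of _ "2 * pi"] conjI allI impI)
      fix y assume y: "y \<in> closed_segment c d \<and> f y \<noteq> f x"
      then obtain n n' :: int where n: "f y = 2 * pi * n" "f x = 2 * pi * n'" using int x by meson
      then have "n \<noteq> n'" using y by auto
      then have "1 \<le> \<bar>real_of_int (n - n')\<bar>" by linarith
      moreover have "f y - f x = 2 * pi * real_of_int (n - n')" unfolding n by (simp add: algebra_simps)
      ultimately show "2 * pi \<le> norm (f y - f x)" by (simp add: abs_mult)
    qed simp
  qed simp
  then have "f d = f c" unfolding constant_on_def by auto
  then have "Im (l d) - Im (l c) = Im (m d) - Im (m c)" by (simp add: f_def)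
  then show ?thesis using m(3,4) by auto
qed

text \<open>Around the closed polygon \<open>ls\<close> the changes of the logarithm \<open>l\<close> and of the principal arguments
  both telescope to zero.  So the full turns, one for each overcrossing, cancel as well.\<close>

lemma overcrossings_even:
  assumes vs: "vs \<noteq> []" and ls: "ls \<noteq> []" "last ls = hd ls"
    and gen: "general_position (set vs \<union> set ls)" and disj: "set vs \<inter> set ls = {}"
    and ne: "\<And>a b. (a, b) \<in> set (steps (vs @ [hd vs])) \<union> set (steps ls) \<Longrightarrow> a \<noteq> b"
    and seg: "\<And>a b c d. (a, b) \<in> set (steps (vs @ [hd vs])) \<Longrightarrow> (c, d) \<in> set (steps ls) \<Longrightarrow>
       closed_segment a b \<inter> closed_segment c d = {}"
    and l: "continuous_on S l" "\<And>x. x \<in> S \<Longrightarrow> holonomy (map (\<lambda>v. v - x) vs) = exp (l x)"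
    and S: "\<And>c d. (c, d) \<in> set (steps ls) \<Longrightarrow> closed_segment c d \<subseteq> S"
  shows "even (overcrossings (vs @ [hd vs]) ls)"
proof -
  let ?ss = "steps (vs @ [hd vs])"
  define g where "g = (\<lambda>x. \<Sum>(a, b)\<leftarrow>?ss. Arg (view a b x))"
  have mem: "a \<in> set vs" "b \<in> set vs" if "(a, b) \<in> set ?ss" for a b
    using set_steps[OF that] vs by auto
  have change: "\<exists>k::int. Im (l d) - Im (l c) = g d - g c + 2 * pi * k \<and>
     (odd k \<longleftrightarrow> odd (\<Sum>s\<leftarrow>?ss. of_bool (over s (c, d)) :: int))" if cd: "(c, d) \<in> set (steps ls)" for c d
    unfolding g_def
  proof (rule holonomy_change_along_segment[OF vs])
    have cd': "c \<in> set ls" "d \<in> set ls" "c \<noteq> d" using set_steps[OF cd] ne cd by auto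
    show vert: "fst v \<noteq> fst x" if v: "v \<in> set vs" and x: "x \<in> closed_segment c d" for v x
    proof
      assume "fst v = fst x"
      obtain t where "x = (1 - t) *\<^sub>R c + t *\<^sub>R d" using x unfolding in_segment by blast
      then have "ccw (fst c) (fst d) (fst v) = 0"
        unfolding \<open>fst v = fst x\<close> by (simp add: ccw_affine ccw_degenerate)
      moreover have "distinct [c, d, v]" using v cd' disj by auto
      ultimately show False using gen v cd' unfolding general_position_def by blast
    qed
    fix s assume s: "s \<in> set ?ss"
    then obtain a b where ab: "s = (a, b)" "a \<in> set vs" "b \<in> set vs" "a \<noteq> b"
      using mem ne by (metis UnI1 surj_pair)
    then have "distinct [a, b, c]" "distinct [a, b, d]" using cd' disj by auto
    then show "Im (view (fst s) (snd s) c) \<noteq> 0 \<and> Im (view (fst s) (snd s) d) \<noteq> 0"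
      using gen ab cd' unfolding general_position_def Im_view by (metis UnCI fst_conv snd_conv)
    fix x assume x: "x \<in> closed_segment c d"
    have "x \<notin> closed_segment a b" using seg[of a b c d] s cd x ab(1) by auto
    then show "view (fst s) (snd s) x \<noteq> 0"
      using view_nonzero[of a x b] vert[OF ab(2) x] vert[OF ab(3) x] ab(1) by simp
  next
    show "continuous_on (closed_segment c d) l" using l(1) S[OF cd] by (rule continuous_on_subset)
    show "holonomy (map (\<lambda>v. v - x) vs) = exp (l x)" if "x \<in> closed_segment c d" for x
      using l(2) S[OF cd] that by blast
  qed
  have ex: "\<forall>t \<in> set (steps ls). \<exists>k::int. (case t of (c, d) \<Rightarrow> Im (l d) - Im (l c) - (g d - g c)) = 2 * pi * k \<and>
     (odd k \<longleftrightarrow> odd (\<Sum>s\<leftarrow>?ss. of_bool (over s t) :: int))"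
  proof
    fix t assume t: "t \<in> set (steps ls)"
    obtain c d where cd: "t = (c, d)" by (cases t)
    obtain k :: int where "Im (l d) - Im (l c) = g d - g c + 2 * pi * k"
      "odd k \<longleftrightarrow> odd (\<Sum>s\<leftarrow>?ss. of_bool (over s (c, d)) :: int)"
      using change t unfolding cd by blast
    then show "\<exists>k::int. (case t of (c, d) \<Rightarrow> Im (l d) - Im (l c) - (g d - g c)) = 2 * pi * k \<and>
       (odd k \<longleftrightarrow> odd (\<Sum>s\<leftarrow>?ss. of_bool (over s t) :: int))"
      unfolding cd by (intro exI[of _ k]) simp
  qed
  from bchoice[OF ex] obtain K :: "space \<times> space \<Rightarrow> int" where K: "\<forall>t \<in> set (steps ls).
     (case t of (c, d) \<Rightarrow> Im (l d) - Im (l c) - (g d - g c)) = 2 * pi * K t \<and>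
     (odd (K t) \<longleftrightarrow> odd (\<Sum>s\<leftarrow>?ss. of_bool (over s t) :: int))"
    by blast
  have "2 * pi * real_of_int (\<Sum>t\<leftarrow>ts. K t) = (\<Sum>t\<leftarrow>ts. 2 * pi * real_of_int (K t))" for ts
    by (induction ts) (auto simp: distrib_left)
  from this[of "steps ls"]
  have "2 * pi * real_of_int (\<Sum>t\<leftarrow>steps ls. K t) = (\<Sum>t\<leftarrow>steps ls. 2 * pi * real_of_int (K t))" .
  also have "\<dots> = (\<Sum>t\<leftarrow>steps ls. case t of (c, d) \<Rightarrow> (Im (l d) - g d) - (Im (l c) - g c))"
  proof (rule arg_cong[of _ _ sum_list], rule map_cong[OF refl])
    fix t assume "t \<in> set (steps ls)"
    then have "(case t of (c, d) \<Rightarrow> Im (l d) - Im (l c) - (g d - g c)) = 2 * pi * K t" using K by blast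
    then show "2 * pi * K t = (case t of (c, d) \<Rightarrow> (Im (l d) - g d) - (Im (l c) - g c))"
      by (cases t) simp
  qed
  also have "\<dots> = 0"
    using sum_list_steps_telescope[OF ls(1), of "\<lambda>x. Im (l x) - g x"] ls(2) by simp
  finally have "(\<Sum>t\<leftarrow>steps ls. K t) = 0" by (simp only: mult_eq_0_iff of_int_eq_0_iff) simp
  then have "even (\<Sum>t\<leftarrow>steps ls. \<Sum>s\<leftarrow>?ss. of_bool (over s t) :: int)"
    using even_sum_list_cong[of "steps ls" K "\<lambda>t. \<Sum>s\<leftarrow>?ss. of_bool (over s t)"] K by simp
  then show ?thesis
    unfolding overcrossings_def by (subst sum_list_swap)
qed

text \<open>The holonomy of a polygon in \<open>U\<close> does not vanish outside \<open>U\<close>, hence has a logarithm on \<open>V\<close>.\<close>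

lemma log_separated_overcrossings_even:
  assumes sep: "logarithmically_separated U V"
    and ks: "closed_walk ks" "\<And>a b. (a, b) \<in> set (steps ks) \<Longrightarrow> a \<noteq> b \<and> closed_segment a b \<subseteq> U"
    and ls: "closed_walk ls" "\<And>a b. (a, b) \<in> set (steps ls) \<Longrightarrow> a \<noteq> b \<and> closed_segment a b \<subseteq> V"
    and gen: "general_position (set ks \<union> set ls)" "set ks \<inter> set ls = {}"
  shows "even (overcrossings ks ls)"
proof -
  define vs where "vs = butlast ks"
  have vs: "vs \<noteq> []" using ks(1) by (cases ks) (auto simp: vs_def closed_walk_def)
  have "hd vs = hd ks" using ks(1) by (cases ks) (auto simp: vs_def closed_walk_def)
  then have ks_eq: "ks = vs @ [hd vs]"
    using ks(1) vs unfolding closed_walk_def vs_def by (metis append_butlast_last_id butlast.simps(1))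
  have "set vs = set ks" using vs by (subst ks_eq) auto
  let ?\<theta> = "\<lambda>x. holonomy (map (\<lambda>k. k - x) vs)"
  have nz: "?\<theta> x \<noteq> 0" if x: "x \<notin> U" for x
  proof (rule holonomy_nonzero)
    fix v w assume "(v, w) \<in> set (steps (map (\<lambda>k. k - x) vs @ [hd (map (\<lambda>k. k - x) vs)]))"
    moreover have "map (\<lambda>k. k - x) vs @ [hd (map (\<lambda>k. k - x) vs)] = map (\<lambda>k. k - x) ks"
      using vs by (subst ks_eq) (simp add: hd_map)
    ultimately obtain a b where ab: "(a, b) \<in> set (steps ks)" "v = a - x" "w = b - x"
      by (auto simp: steps_map)
    show "0 \<notin> closed_segment v w"
    proof
      assume "0 \<in> closed_segment v w"
      then have "x + 0 \<in> (+) x ` closed_segment (a - x) (b - x)" unfolding ab by blast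
      also have "\<dots> = closed_segment a b" by (simp flip: closed_segment_translation)
      finally show False using ks(2)[OF ab(1)] x by auto
    qed
  qed (use vs in simp)
  have "\<exists>l. continuous_on V l \<and> (\<forall>x\<in>V. \<theta> x = exp (l x))"
    if "continuous_on (- U) \<theta>" "0 \<notin> \<theta> ` (- U)" for \<theta> :: "space \<Rightarrow> complex"
    using sep that unfolding logarithmically_separated_def by simp
  from this[of ?\<theta>, OF continuous_on_holonomy] nz
  obtain l where l: "continuous_on V l" "\<And>x. x \<in> V \<Longrightarrow> ?\<theta> x = exp (l x)"
    by (auto simp: image_iff)
  have UV: "U \<inter> V = {}" using sep by (simp add: logarithmically_separated_def)
  have "even (overcrossings (vs @ [hd vs]) ls)"
  proof (rule overcrossings_even[OF vs, where S = V and l = l])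
    show "ls \<noteq> []" "last ls = hd ls" using ls(1) by (auto simp: closed_walk_def)
    show "general_position (set vs \<union> set ls)" "set vs \<inter> set ls = {}"
      using gen \<open>set vs = set ks\<close> by auto
    show "a \<noteq> b" if "(a, b) \<in> set (steps (vs @ [hd vs])) \<union> set (steps ls)" for a b
      using that ks(2)[of a b] ls(2)[of a b] unfolding ks_eq[symmetric] by auto
    show "closed_segment a b \<inter> closed_segment c d = {}"
      if "(a, b) \<in> set (steps (vs @ [hd vs]))" "(c, d) \<in> set (steps ls)" for a b c d
      using that ks(2)[of a b] ls(2)[of c d] UV unfolding ks_eq[symmetric] by blast
    show "closed_segment c d \<subseteq> V" if "(c, d) \<in> set (steps ls)" for c d
      using ls(2)[OF that] by simp
    show "continuous_on V l" by (rule l(1))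
    show "holonomy (map (\<lambda>v. v - x) vs) = exp (l x)" if "x \<in> V" for x by (rule l(2)[OF that])
  qed
  then show ?thesis using ks_eq by simp
qed

section \<open>Crossing parity of two polygonal arcs\<close>

definition turning :: "space \<Rightarrow> space list \<Rightarrow> real" where
  "turning p ys = (\<Sum>(c, d)\<leftarrow>steps ys. angle_at (fst p) (fst c) (fst d))"

text \<open>Each of the four angles of \<open>angle_defect\<close> belongs to an end of one segment and the whole of
  the other one; summing along the latter gives a turning angle, summing along the former telescopes.\<close>

lemma total_angle_defect:
  assumes "xs \<noteq> []" "ys \<noteq> []"
  shows "(\<Sum>(a, b)\<leftarrow>steps xs. \<Sum>(c, d)\<leftarrow>steps ys. angle_defect (fst a) (fst b) (fst c) (fst d))
     = turning (hd xs) ys - turning (last xs) ys - turning (hd ys) xs + turning (last ys) xs"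
proof -
  let ?A = "\<lambda>x (y, z). angle_at (fst x) (fst y) (fst z)"
  have "(\<Sum>(a, b)\<leftarrow>steps xs. \<Sum>(c, d)\<leftarrow>steps ys. angle_defect (fst a) (fst b) (fst c) (fst d))
    = (\<Sum>s\<leftarrow>steps xs. \<Sum>t\<leftarrow>steps ys. (?A (fst s) t - ?A (snd s) t) - (?A (fst t) s - ?A (snd t) s))"
    by (simp add: angle_defect_def case_prod_unfold algebra_simps)
  also have "\<dots> = (\<Sum>s\<leftarrow>steps xs. \<Sum>t\<leftarrow>steps ys. ?A (fst s) t - ?A (snd s) t)
      - (\<Sum>s\<leftarrow>steps xs. \<Sum>t\<leftarrow>steps ys. ?A (fst t) s - ?A (snd t) s)"
    by (simp only: sum_list_subtractf)
  also have "(\<Sum>s\<leftarrow>steps xs. \<Sum>t\<leftarrow>steps ys. ?A (fst t) s - ?A (snd t) s)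
      = (\<Sum>t\<leftarrow>steps ys. \<Sum>s\<leftarrow>steps xs. ?A (fst t) s - ?A (snd t) s)"
    by (rule sum_list_swap)
  also have "\<dots> = (\<Sum>(c, d)\<leftarrow>steps ys. turning c xs - turning d xs)"
    by (simp add: turning_def sum_list_subtractf case_prod_unfold)
  also have "\<dots> = turning (hd ys) xs - turning (last ys) xs"
    by (rule sum_list_steps_telescope'[OF assms(2)])
  also have "(\<Sum>s\<leftarrow>steps xs. \<Sum>t\<leftarrow>steps ys. ?A (fst s) t - ?A (snd s) t)
      = (\<Sum>(a, b)\<leftarrow>steps xs. turning a ys - turning b ys)"
    by (simp add: turning_def sum_list_subtractf case_prod_unfold)
  also have "\<dots> = turning (hd xs) ys - turning (last xs) ys"
    by (rule sum_list_steps_telescope'[OF assms(1)])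
  finally show ?thesis by simp
qed

lemma sum_list_int_multiples:
  fixes f :: "'a \<Rightarrow> real" and h :: "'a \<Rightarrow> int"
  assumes "\<And>x. x \<in> set xs \<Longrightarrow> \<exists>k::int. f x = 2 * pi * k \<and> (odd k \<longleftrightarrow> odd (h x))"
  shows "\<exists>k::int. (\<Sum>x\<leftarrow>xs. f x) = 2 * pi * k \<and> (odd k \<longleftrightarrow> odd (\<Sum>x\<leftarrow>xs. h x))"
  using assms
proof (induction xs)
  case (Cons x xs)
  obtain k :: int where k: "(\<Sum>x\<leftarrow>xs. f x) = 2 * pi * k" "odd k \<longleftrightarrow> odd (\<Sum>x\<leftarrow>xs. h x)"
    using Cons by auto
  obtain j :: int where j: "f x = 2 * pi * j" "odd j \<longleftrightarrow> odd (h x)" using Cons.prems[of x] by auto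
  show ?case by (intro exI[of _ "j + k"]) (use j k in \<open>auto simp: algebra_simps\<close>)
qed (auto intro!: exI[of _ 0])

text \<open>The parity of the number of crossings in the projection is determined by the turning
  angles around the four ends.\<close>

lemma polygonal_crossing_parity:
  assumes "xs \<noteq> []" "ys \<noteq> []" and gen: "general_position (set xs \<union> set ys)"
    and disj: "set xs \<inter> set ys = {}"
    and ne: "\<And>a b. (a, b) \<in> set (steps xs) \<union> set (steps ys) \<Longrightarrow> a \<noteq> b"
    and seg: "\<And>a b c d. (a, b) \<in> set (steps xs) \<Longrightarrow> (c, d) \<in> set (steps ys) \<Longrightarrow>
       closed_segment a b \<inter> closed_segment c d = {}"
  shows "\<exists>k::int. turning (hd xs) ys - turning (last xs) ys - turning (hd ys) xs + turning (last ys) xs = 2 * pi * k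
     \<and> (odd k \<longleftrightarrow> odd (overcrossings xs ys + overcrossings ys xs))"
proof -
  have pair: "\<exists>k::int. angle_defect (fst a) (fst b) (fst c) (fst d) = 2 * pi * k \<and>
      (odd k \<longleftrightarrow> odd (of_bool (over (a, b) (c, d)) + of_bool (over (c, d) (a, b)) :: int))"
    if ab: "(a, b) \<in> set (steps xs)" and cd: "(c, d) \<in> set (steps ys)" for a b c d
  proof -
    have mem: "a \<in> set xs" "b \<in> set xs" "c \<in> set ys" "d \<in> set ys"
      using set_steps ab cd by metis+
    have "a \<noteq> b" "c \<noteq> d" using ne ab cd by auto
    then have "distinct [a, b, c]" "distinct [a, b, d]" "distinct [c, d, a]" "distinct [c, d, b]"
      using mem disj by auto
    then have nz: "ccw (fst a) (fst b) (fst c) \<noteq> 0" "ccw (fst a) (fst b) (fst d) \<noteq> 0"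
      "ccw (fst c) (fst d) (fst a) \<noteq> 0" "ccw (fst c) (fst d) (fst b) \<noteq> 0"
      using gen mem unfolding general_position_def by blast+
    obtain k :: int where "angle_defect (fst a) (fst b) (fst c) (fst d) = 2 * pi * k"
      "odd k \<longleftrightarrow> crossing (fst a) (fst b) (fst c) (fst d)"
      using angle_defect_crossing[OF nz] by blast
    then show ?thesis
      using crossing_iff_over_flip[OF nz seg[OF ab cd]] by (intro exI[of _ k]) auto
  qed
  have "\<exists>k::int. (\<Sum>s\<leftarrow>steps xs. \<Sum>t\<leftarrow>steps ys. (\<lambda>(a, b) (c, d). angle_defect (fst a) (fst b) (fst c) (fst d)) s t) = 2 * pi * k \<and>
      (odd k \<longleftrightarrow> odd (\<Sum>s\<leftarrow>steps xs. \<Sum>t\<leftarrow>steps ys. of_bool (over s t) + of_bool (over t s) :: int))"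
  proof (rule sum_list_int_multiples, rule sum_list_int_multiples)
    fix s t assume "s \<in> set (steps xs)" "t \<in> set (steps ys)"
    then show "\<exists>k::int. (\<lambda>(a, b) (c, d). angle_defect (fst a) (fst b) (fst c) (fst d)) s t = 2 * pi * k \<and>
       (odd k \<longleftrightarrow> odd (of_bool (over s t) + of_bool (over t s) :: int))"
      using pair[of "fst s" "snd s" "fst t" "snd t"] by (simp add: case_prod_unfold)
  qed
  moreover have "(\<Sum>s\<leftarrow>steps xs. \<Sum>t\<leftarrow>steps ys. of_bool (over s t) + of_bool (over t s))
      = overcrossings xs ys + overcrossings ys xs"
    unfolding overcrossings_def sum_list_addf by (subst (2) sum_list_swap) (rule refl)
  moreover have "(\<Sum>s\<leftarrow>steps xs. \<Sum>t\<leftarrow>steps ys. (\<lambda>(a, b) (c, d). angle_defect (fst a) (fst b) (fst c) (fst d)) s t)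
     = turning (hd xs) ys - turning (last xs) ys - turning (hd ys) xs + turning (last ys) xs"
    unfolding total_angle_defect[OF assms(1,2), symmetric] by (simp add: case_prod_unfold)
  ultimately show ?thesis by simp
qed

lemma turning_eq_Arg_difference:
  assumes "ys \<noteq> []" "\<And>y. y \<in> set ys \<Longrightarrow> fst y \<noteq> fst p"
  shows "\<exists>m::int. turning p ys = Arg (fst (last ys) - fst p) - Arg (fst (hd ys) - fst p) + 2 * pi * m"
  using assms
proof (induction ys rule: induct_list012)
  case (2 y)
  then show ?case by (intro exI[of _ 0]) (simp add: turning_def)
next
  case (3 y z ys)
  obtain m :: int where m: "turning p (z # ys) = Arg (fst (last (z # ys)) - fst p) - Arg (fst z - fst p) + 2 * pi * m"
    using 3 by auto
  define a where "a = fst y - fst p"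
  define b where "b = fst z - fst p"
  have nz: "a \<noteq> 0" "b \<noteq> 0" using "3.prems" by (auto simp: a_def b_def)
  have "cis (Arg (b / a) - (Arg b - Arg a)) = sgn (b / a) / (sgn b / sgn a)"
    using nz by (simp add: cis_Arg flip: cis_divide)
  also have "\<dots> = 1" using nz by (simp add: sgn_divide sgn_zero_iff)
  finally have "exp (\<i> * of_real (Arg (b / a) - (Arg b - Arg a))) = 1"
    by (simp only: cis_conv_exp)
  then obtain k :: int where "Arg (b / a) - (Arg b - Arg a) = of_int (2 * k) * pi"
    unfolding exp_eq_1 by auto
  then have "angle_at (fst p) (fst y) (fst z) = Arg b - Arg a + 2 * pi * k"
    by (simp add: angle_at_def a_def b_def algebra_simps)
  then show ?case
    using m by (intro exI[of _ "k + m"]) (simp add: turning_def a_def b_def algebra_simps)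
qed simp

text \<open>A choice of the argument of the direction from \<open>u\<close> to \<open>v\<close> for which reversing the direction subtracts
  exactly \<open>\<pi>\<close> if \<open>u < v\<close>.\<close>

definition direction :: "('v::linorder \<Rightarrow> space) \<Rightarrow> 'v \<Rightarrow> 'v \<Rightarrow> real" where
  "direction pos u v = (if u < v then Arg (fst (pos v) - fst (pos u)) else Arg (fst (pos u) - fst (pos v)) - pi)"

lemma direction_reverse: "u \<noteq> v \<Longrightarrow> direction pos u v - direction pos v u = pi - 2 * pi * of_bool (v < u)"
  unfolding direction_def by auto

lemma direction_eq_Arg:
  assumes "u \<noteq> v" "fst (pos u) \<noteq> fst (pos v)"
  shows "\<exists>k::int. Arg (fst (pos v) - fst (pos u)) = direction pos u v + 2 * pi * k"
proof (cases "u < v")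
  case True
  then show ?thesis by (intro exI[of _ 0]) (simp add: direction_def)
next
  case False
  define z where "z = fst (pos u) - fst (pos v)"
  have "z \<noteq> 0" using assms by (simp add: z_def)
  have "Arg (fst (pos v) - fst (pos u)) = Arg (- z)" by (simp add: z_def)
  also have "\<dots> = direction pos u v + 2 * pi * of_int (if Arg z \<le> 0 then 1 else 0)"
    using False Arg_minus[OF \<open>z \<noteq> 0\<close>] by (simp add: direction_def z_def)
  finally show ?thesis by blast
qed

text \<open>For four distinct ends, odd exactly if the ends of the arcs separate each other in the linear order of the labels; this is
  the crossing number of the two chords when the vertices are placed on a circle in this order.\<close>

definition interlacing :: "'v::linorder \<times> 'v \<Rightarrow> 'v \<times> 'v \<Rightarrow> int" where
  "interlacing e e' = of_bool (fst e' < fst e) + of_bool (fst e' < snd e) + of_bool (snd e' < fst e) + of_bool (snd e' < snd e)"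

lemma turning_eq_direction_difference:
  assumes "ys \<noteq> []" "hd ys = pos u" "last ys = pos v" "w \<noteq> u" "w \<noteq> v"
    and "\<And>y. y \<in> set ys \<Longrightarrow> fst y \<noteq> fst (pos w)"
  shows "\<exists>m::int. turning (pos w) ys = direction pos w v - direction pos w u + 2 * pi * m"
proof -
  have "fst (pos w) \<noteq> fst (pos u)" "fst (pos w) \<noteq> fst (pos v)"
    using assms(1-3,6) hd_in_set last_in_set by metis+
  then obtain k k' :: int where
    "Arg (fst (pos u) - fst (pos w)) = direction pos w u + 2 * pi * k"
    "Arg (fst (pos v) - fst (pos w)) = direction pos w v + 2 * pi * k'"
    using direction_eq_Arg assms(4,5) by metis
  moreover obtain m :: int where
    "turning (pos w) ys = Arg (fst (pos v) - fst (pos w)) - Arg (fst (pos u) - fst (pos w)) + 2 * pi * m"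
    using turning_eq_Arg_difference[OF assms(1,6)] assms(2,3) by auto
  ultimately show ?thesis
    by (intro exI[of _ "m + k' - k"]) (simp add: algebra_simps)
qed

text \<open>Every turning angle is the difference of two directions plus \<open>2 \<pi> m\<close>.  The eight directions
  combine into four pairs of opposite ones, which contribute \<open>\<plusminus> \<pi>\<close> each, according to the order of the labels.\<close>

lemma arc_crossing_parity:
  fixes pos :: "'v::linorder \<Rightarrow> space" and pl :: "'v \<times> 'v \<Rightarrow> space list"
  assumes e: "pl e \<noteq> []" "hd (pl e) = pos (fst e)" "last (pl e) = pos (snd e)"
    and e': "pl e' \<noteq> []" "hd (pl e') = pos (fst e')" "last (pl e') = pos (snd e')"
    and ends: "{fst e, snd e} \<inter> {fst e', snd e'} = {}"
    and gen: "general_position (set (pl e) \<union> set (pl e'))" "set (pl e) \<inter> set (pl e') = {}"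
       "\<And>a b. (a, b) \<in> set (steps (pl e)) \<union> set (steps (pl e')) \<Longrightarrow> a \<noteq> b"
       "\<And>a b c d. (a, b) \<in> set (steps (pl e)) \<Longrightarrow> (c, d) \<in> set (steps (pl e')) \<Longrightarrow>
         closed_segment a b \<inter> closed_segment c d = {}"
    and m: "\<And>w. w \<in> {fst e, snd e} \<Longrightarrow>
        turning (pos w) (pl e') = direction pos w (snd e') - direction pos w (fst e') + 2 * pi * of_int (m w e')"
      "\<And>w. w \<in> {fst e', snd e'} \<Longrightarrow>
        turning (pos w) (pl e) = direction pos w (snd e) - direction pos w (fst e) + 2 * pi * of_int (m w e)"
  shows "odd (overcrossings (pl e) (pl e') + overcrossings (pl e') (pl e)) \<longleftrightarrow>
     odd (interlacing e e' + (m (fst e) e' + m (snd e) e') + (m (fst e') e + m (snd e') e))"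
proof -
  obtain u v where uv: "e = (u, v)" by force
  obtain u' v' where uv': "e' = (u', v')" by force
  have "\<exists>k::int. turning (pos u) (pl e') - turning (pos v) (pl e') - turning (pos u') (pl e) + turning (pos v') (pl e) = 2 * pi * k
     \<and> (odd k \<longleftrightarrow> odd (overcrossings (pl e) (pl e') + overcrossings (pl e') (pl e)))"
    using polygonal_crossing_parity[OF e(1) e'(1) gen] unfolding e e' unfolding uv uv' fst_conv snd_conv .
  then obtain k :: int where k: "turning (pos u) (pl e') - turning (pos v) (pl e') - turning (pos u') (pl e) + turning (pos v') (pl e) = 2 * pi * k"
    "odd k \<longleftrightarrow> odd (overcrossings (pl e) (pl e') + overcrossings (pl e') (pl e))"
    by blast
  \<comment> \<open>A signed form of \<open>interlacing\<close>: the four pairs of opposite directions leave \<open>\<pi>\<close> each, with signs that cancel, and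
    \<open>2 \<pi>\<close> for every pair in decreasing order.\<close>
  define i :: int where "i = of_bool (u' < u) - of_bool (v' < u) + of_bool (v' < v) - of_bool (u' < v)"
  let ?d = "direction pos"
  have ne: "u \<noteq> u'" "u \<noteq> v'" "v \<noteq> u'" "v \<noteq> v'" using ends by (auto simp: uv uv')
  have "2 * pi * real_of_int k = (?d u v' - ?d u u') - (?d v v' - ?d v u') - (?d u' v - ?d u' u) + (?d v' v - ?d v' u)
      + 2 * pi * (real_of_int (m u e') - real_of_int (m v e') - real_of_int (m u' e) + real_of_int (m v' e))"
    using k(1) m(1)[of u] m(1)[of v] m(2)[of u'] m(2)[of v'] by (simp add: uv uv' algebra_simps)
  also have "(?d u v' - ?d u u') - (?d v v' - ?d v u') - (?d u' v - ?d u' u) + (?d v' v - ?d v' u)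
      = (?d u v' - ?d v' u) - (?d u u' - ?d u' u) - (?d v v' - ?d v' v) + (?d v u' - ?d u' v)"
    by simp
  also have "\<dots> = 2 * pi * real_of_int i"
    using ne by (simp add: direction_reverse i_def algebra_simps)
  finally have "2 * pi * real_of_int k = 2 * pi * real_of_int (i + m u e' - m v e' - m u' e + m v' e)"
    by (simp add: algebra_simps)
  then have "k = i + m u e' - m v e' - m u' e + m v' e"
    by (metis mult_left_cancel of_int_eq_iff pi_neq_zero mult_eq_0_iff zero_neq_numeral)
  moreover have "odd i \<longleftrightarrow> odd (interlacing e e')"
    by (auto simp: i_def interlacing_def uv uv')
  ultimately have "odd k \<longleftrightarrow> odd (interlacing e e' + (m u e' + m v e') + (m u' e + m v' e))"
    by auto
  then show ?thesis using k(2) by (simp add: uv uv')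
qed

section \<open>Parity certificates for lists of cycle pairs\<close>

definition opposite_arcs :: "('v list \<times> 'v list) list \<Rightarrow> (('v \<times> 'v) \<times> ('v \<times> 'v)) list" where
  "opposite_arcs P = concat (map (\<lambda>(C, D). List.product (steps C) (steps D)) P)"

lemma sum_list_product:
  fixes f :: "'a \<times> 'b \<Rightarrow> 'c::comm_monoid_add"
  shows "(\<Sum>x\<leftarrow>List.product xs ys. f x) = (\<Sum>x\<leftarrow>xs. \<Sum>y\<leftarrow>ys. f (x, y))"
  by (induction xs) (auto simp: comp_def)

lemma sum_list_opposite_arcs:
  fixes f :: "('v \<times> 'v) \<times> ('v \<times> 'v) \<Rightarrow> 'c::comm_monoid_add"
  shows "(\<Sum>x\<leftarrow>opposite_arcs P. f x) = (\<Sum>(C, D)\<leftarrow>P. \<Sum>e\<leftarrow>steps C. \<Sum>e'\<leftarrow>steps D. f (e, e'))"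
  by (induction P) (auto simp: opposite_arcs_def sum_list_product)

lemma sum_list_eq_sum_count:
  fixes f :: "'a \<Rightarrow> int"
  assumes "finite U" "set xs \<subseteq> U"
  shows "(\<Sum>x\<leftarrow>xs. f x) = (\<Sum>x\<in>U. int (count_list xs x) * f x)"
  using assms(2)
proof (induction xs)
  case (Cons a xs)
  have "(\<Sum>x\<in>U. int (count_list (a # xs) x) * f x) = (\<Sum>x\<in>U. int (count_list xs x) * f x + (if x = a then f x else 0))"
    by (rule sum.cong) (auto simp: algebra_simps)
  also have "\<dots> = (\<Sum>x\<leftarrow>xs. f x) + f a"
    using Cons assms(1) by (simp add: sum.distrib)
  finally show ?case by simp
qed simp

text \<open>If \<open>x\<close> and its mirror image occur equally often mod 2, the ordered pairs may be replaced by unordered ones,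
  each carrying the sum of the values for its two orders.\<close>

lemma sum_list_symmetric_parity:
  fixes X :: "(('v::linorder \<times> 'v) \<times> ('v \<times> 'v)) list" and f :: "('v \<times> 'v) \<times> ('v \<times> 'v) \<Rightarrow> int"
  assumes sym: "\<And>x. x \<in> set X \<Longrightarrow> even (count_list X x + count_list X (prod.swap x))"
    and tails: "\<And>e e'. (e, e') \<in> set X \<Longrightarrow> fst e \<noteq> fst e'"
  shows "even (\<Sum>x\<leftarrow>X. f x) \<longleftrightarrow> even (\<Sum>x\<leftarrow>filter (\<lambda>(e, e'). fst e < fst e') X. f x + f (prod.swap x))"
proof -
  let ?less = "\<lambda>(e, e'). fst e < fst (e' :: 'v \<times> 'v)"
  define U where "U = set X \<union> prod.swap ` set X"
  define L where "L = {x \<in> U. ?less x}"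
  have fin: "finite U" "finite L" by (auto simp: U_def L_def)
  have U: "U = L \<union> prod.swap ` L" "L \<inter> prod.swap ` L = {}"
    using tails unfolding U_def L_def by (force dest: not_less_iff_gr_or_eq[THEN iffD1])+
  have sym': "even (count_list X x + count_list X (prod.swap x))" for x
  proof (cases "x \<in> set X \<or> prod.swap x \<in> set X")
    case True
    then show ?thesis using sym[of x] sym[of "prod.swap x"] by (auto simp: add.commute)
  next
    case False
    then show ?thesis by (simp add: count_list_0_iff)
  qed
  have "(\<Sum>x\<leftarrow>X. f x) = (\<Sum>x\<in>U. int (count_list X x) * f x)"
    by (rule sum_list_eq_sum_count) (auto simp: fin U_def)
  also have "\<dots> = (\<Sum>x\<in>L. int (count_list X x) * f x) + (\<Sum>x\<in>prod.swap ` L. int (count_list X x) * f x)"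
    unfolding U(1) using fin U(2) by (intro sum.union_disjoint) auto
  also have "(\<Sum>x\<in>prod.swap ` L. int (count_list X x) * f x) = (\<Sum>x\<in>L. int (count_list X (prod.swap x)) * f (prod.swap x))"
    by (subst sum.reindex) (auto simp: comp_def)
  also have "(\<Sum>x\<in>L. int (count_list X x) * f x) + \<dots>
      = (\<Sum>x\<in>L. int (count_list X x) * (f x + f (prod.swap x)))
        + (\<Sum>x\<in>L. (int (count_list X (prod.swap x)) - int (count_list X x)) * f (prod.swap x))"
    by (simp add: algebra_simps flip: sum.distrib)
  also have "(\<Sum>x\<in>L. int (count_list X x) * (f x + f (prod.swap x)))
      = (\<Sum>x\<in>L. int (count_list (filter ?less X) x) * (f x + f (prod.swap x)))"
    by (rule sum.cong) (auto simp: L_def count_list_eq_length_filter conj_commute intro!: arg_cong[of _ _ length] filter_cong)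
  also have "\<dots> = (\<Sum>x\<leftarrow>filter ?less X. f x + f (prod.swap x))"
    by (rule sum_list_eq_sum_count[symmetric]) (auto simp: L_def U_def)
  finally have "(\<Sum>x\<leftarrow>X. f x) = (\<Sum>x\<leftarrow>filter ?less X. f x + f (prod.swap x))
      + (\<Sum>x\<in>L. (int (count_list X (prod.swap x)) - int (count_list X x)) * f (prod.swap x))" .
  moreover have "even (\<Sum>x\<in>L. (int (count_list X (prod.swap x)) - int (count_list X x)) * f (prod.swap x))"
    by (rule dvd_sum) (use sym' in \<open>auto simp: even_diff_iff\<close>)
  ultimately show ?thesis by simp
qed

text \<open>Every visit of a closed walk to a vertex ends one edge and starts another.\<close>

lemma even_sum_closed_walk:
  fixes g :: "'v \<Rightarrow> int"
  assumes "closed_walk C"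
  shows "even (\<Sum>e\<leftarrow>steps C. g (fst e) + g (snd e))"
proof -
  have "(\<Sum>(a, b)\<leftarrow>steps C. g b - g a) = 0"
    using sum_list_steps_telescope[of C g] assms by (cases C) (auto simp: closed_walk_def)
  moreover have "(\<Sum>e\<leftarrow>xs. g (fst e) + g (snd e)) = (\<Sum>(a, b)\<leftarrow>xs. g b - g a) + 2 * (\<Sum>e\<leftarrow>xs. g (fst e))" for xs
    by (induction xs) auto
  ultimately show ?thesis by simp
qed

text \<open>The two parity conditions of the Conway--Gordon argument: the sum of the linking numbers of the pairs is
  unchanged when two arcs pass through each other, and its value is odd when the vertices are put on a circle.\<close>

definition linking_certificate :: "('v::linorder list \<times> 'v list) list \<Rightarrow> bool" where
  "linking_certificate P \<longleftrightarrow>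
     (\<forall>(C, D) \<in> set P. closed_walk C \<and> closed_walk D \<and> set C \<inter> set D = {}) \<and>
     (\<forall>x \<in> set (opposite_arcs P). even (count_list (opposite_arcs P) x + count_list (opposite_arcs P) (prod.swap x))) \<and>
     odd (\<Sum>(e, e')\<leftarrow>filter (\<lambda>(e, e'). fst e < fst e') (opposite_arcs P). interlacing e e')"

lemma linking_certificate_walks:
  assumes "linking_certificate P" "(C, D) \<in> set P"
  shows "closed_walk C \<and> closed_walk D \<and> set C \<inter> set D = {}"
proof -
  have "\<forall>(C, D) \<in> set P. closed_walk C \<and> closed_walk D \<and> set C \<inter> set D = {}"
    using assms(1) unfolding linking_certificate_def by (elim conjE)
  then show ?thesis using assms(2) by auto
qed

text \<open>Here \<open>f e e'\<close> stands for the overcrossings of \<open>e'\<close> over \<open>e\<close> and \<open>m w e\<close> for the turns of \<open>e\<close> around \<open>w\<close>.  By the symmetry of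
  the list, the sum of all \<open>f\<close> is the sum of the crossing numbers over unordered pairs of arcs, and
  the turns sum up to an even number around each cycle.\<close>

lemma linking_certificate_obstruction:
  fixes f :: "'v::linorder \<times> 'v \<Rightarrow> 'v \<times> 'v \<Rightarrow> int"
  assumes cert: "linking_certificate P"
    and parity: "\<And>e e'. (e, e') \<in> set (opposite_arcs P) \<Longrightarrow> odd (f e e' + f e' e) \<longleftrightarrow>
       odd (interlacing e e' + (m (fst e) e' + m (snd e) e') + (m (fst e') e + m (snd e') e))"
  shows "\<exists>(C, D) \<in> set P. odd (\<Sum>e\<leftarrow>steps C. \<Sum>e'\<leftarrow>steps D. f e e')"
proof (rule ccontr)
  assume even: "\<not> ?thesis"
  let ?X = "opposite_arcs P"
  let ?L = "filter (\<lambda>(e, e'). fst e < fst e') ?X"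
  let ?f = "\<lambda>(e, e'). f e e'" and ?M = "\<lambda>(e, e'). m (fst e) e' + m (snd e) e'"
  have walks: "closed_walk C" "set C \<inter> set D = {}" if "(C, D) \<in> set P" for C D
    using cert that unfolding linking_certificate_def by auto
  have sym: "even (count_list ?X x + count_list ?X (prod.swap x))" if "x \<in> set ?X" for x
    using cert that unfolding linking_certificate_def by simp
  have odd: "odd (\<Sum>(e, e')\<leftarrow>?L. interlacing e e')"
    using cert unfolding linking_certificate_def by simp
  have tails: "fst e \<noteq> fst e'" if ee: "(e, e') \<in> set ?X" for e e'
  proof -
    obtain C D where CD: "(C, D) \<in> set P" "e \<in> set (steps C)" "e' \<in> set (steps D)"
      using ee by (auto simp: opposite_arcs_def)
    then have "fst e \<in> set C" "fst e' \<in> set D"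
      by (metis prod.collapse set_steps)+
    then show ?thesis using walks(2)[OF CD(1)] by auto
  qed
  have dvd_sum_list: "even (\<Sum>x\<leftarrow>xs. h x)" if "\<And>x. x \<in> set xs \<Longrightarrow> even (h x)" for xs :: "'x list" and h :: "'x \<Rightarrow> int"
    using that by (induction xs) auto
  have "even (\<Sum>x\<leftarrow>?X. ?f x)"
    unfolding sum_list_opposite_arcs by (rule dvd_sum_list) (use even in auto)
  moreover have "even (\<Sum>x\<leftarrow>?X. ?M x)"
    unfolding sum_list_opposite_arcs
  proof (rule dvd_sum_list)
    fix p assume p: "p \<in> set P"
    obtain C D where CD: "p = (C, D)" by force
    then have "closed_walk C" using walks p by simp
    have "even (\<Sum>e'\<leftarrow>steps D. \<Sum>e\<leftarrow>steps C. m (fst e) e' + m (snd e) e')"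
      by (rule dvd_sum_list) (rule even_sum_closed_walk[OF \<open>closed_walk C\<close>])
    then show "even (case p of (C, D) \<Rightarrow> \<Sum>e\<leftarrow>steps C. \<Sum>e'\<leftarrow>steps D. ?M (e, e'))"
      by (subst sum_list_swap) (simp add: CD sum_list_swap[of _ "steps C"])
  qed
  ultimately have "even (\<Sum>x\<leftarrow>?L. ?f x + ?f (prod.swap x))" "even (\<Sum>x\<leftarrow>?L. ?M x + ?M (prod.swap x))"
    using sum_list_symmetric_parity[OF sym tails] by blast+
  moreover have "even (\<Sum>x\<leftarrow>?L. ?f x + ?f (prod.swap x)) \<longleftrightarrow>
      even (\<Sum>x\<leftarrow>?L. (case x of (e, e') \<Rightarrow> interlacing e e') + (?M x + ?M (prod.swap x)))"
  proof (rule even_sum_list_cong)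
    fix x assume x: "x \<in> set ?L"
    obtain e e' where ee: "x = (e, e')" by (cases x)
    then have "(e, e') \<in> set ?X" using x by simp
    from parity[OF this]
    show "odd (?f x + ?f (prod.swap x)) \<longleftrightarrow>
        odd ((case x of (e, e') \<Rightarrow> interlacing e e') + (?M x + ?M (prod.swap x)))"
      unfolding ee swap_simp prod.case by (simp only: add.assoc)
  qed
  ultimately have "even (\<Sum>(e, e')\<leftarrow>?L. interlacing e e')"
    by (simp add: sum_list_addf case_prod_unfold)
  then show False using odd by simp
qed

section \<open>Polygonal approximation in general position\<close>

lemma negligible_ccw_line:
  assumes "p \<noteq> q"
  shows "negligible {w. ccw p q w = 0}"
proof -
  define n where "n = \<i> * (q - p)"
  have "n \<noteq> 0" using assms by (simp add: n_def)
  have "{w. ccw p q w = 0} = {w. n \<bullet> w = n \<bullet> p}"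
    by (auto simp: n_def ccw_def inner_complex_def algebra_simps)
  then show ?thesis using negligible_hyperplane[of n] \<open>n \<noteq> 0\<close> by simp
qed

text \<open>Points are added one at a time, avoiding the finitely many lines through two earlier ones.  The heights
  are left alone.\<close>

lemma perturb_to_general_position:
  fixes r :: "'j \<Rightarrow> space"
  assumes "finite J" "\<epsilon> > 0"
  shows "\<exists>q. (\<forall>j\<in>J. dist (q j) (r j) < \<epsilon>) \<and> inj_on (fst \<circ> q) J \<and> general_position (q ` J)"
  using assms(1)
proof (induction J)
  case empty
  show ?case by (simp add: general_position_def)
next
  case (insert j J)
  obtain q where q: "\<forall>j\<in>J. dist (q j) (r j) < \<epsilon>" "inj_on (fst \<circ> q) J" "general_position (q ` J)"
    using insert.IH by blast
  let ?pairs = "{(a, b) \<in> q ` J \<times> q ` J. a \<noteq> b}"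
  define bad where "bad = (fst \<circ> q) ` J \<union> (\<Union>(a, b)\<in>?pairs. {w. ccw (fst a) (fst b) w = 0})"
  have ne: "fst a \<noteq> fst b" if "(a, b) \<in> ?pairs" for a b
    using that q(2) by (auto simp: inj_on_def)
  have "finite ?pairs"
    by (rule finite_subset[of _ "q ` J \<times> q ` J"]) (use insert.hyps in auto)
  moreover have "negligible (case s of (a, b) \<Rightarrow> {w. ccw (fst a) (fst b) w = 0})" if "s \<in> ?pairs" for s
  proof -
    obtain a b where s: "s = (a, b)" by (cases s)
    have "fst a \<noteq> fst b" using ne that unfolding s by blast
    then show ?thesis unfolding s prod.case by (rule negligible_ccw_line)
  qed
  ultimately have "negligible (\<Union>(a, b)\<in>?pairs. {w. ccw (fst a) (fst b) w = 0})"
    by (intro negligible_Union) blast+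
  then have "negligible bad"
    unfolding bad_def using negligible_finite[of "(fst \<circ> q) ` J"] insert.hyps by (intro negligible_Un) simp_all
  moreover have "\<not> negligible (ball (fst (r j)) \<epsilon>)"
    by (rule open_not_negligible) (use assms(2) in auto)
  ultimately obtain w where w: "w \<in> ball (fst (r j)) \<epsilon>" "w \<notin> bad"
    using negligible_subset by blast
  define y where "y = (w, snd (r j))"
  define q' where "q' = q(j := y)"
  have q'J: "q' i = q i" if "i \<in> J" for i using that insert.hyps by (auto simp: q'_def)
  have "q' ` J = q ` J" by (rule image_cong[OF refl]) (rule q'J)
  then have im: "q' ` insert j J = insert y (q ` J)" by (simp only: image_insert) (simp add: q'_def)
  have new: "ccw (fst a) (fst b) (fst y) \<noteq> 0" if "a \<in> q ` J" "b \<in> q ` J" "a \<noteq> b" for a b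
    using w(2) that unfolding bad_def y_def by auto
  show ?case
  proof (intro exI[of _ q'] conjI ballI)
    show "dist (q' i) (r i) < \<epsilon>" if "i \<in> insert j J" for i
      using that q(1) w(1) insert.hyps
      by (auto simp: q'_def y_def dist_Pair_Pair dist_prod_def dist_commute)
    show "inj_on (fst \<circ> q') (insert j J)"
    proof -
      have "inj_on (fst \<circ> q') J" using q(2) q'J by (simp add: inj_on_def)
      moreover have "w \<notin> (fst \<circ> q) ` J" using w(2) by (simp add: bad_def)
      ultimately show ?thesis
        using q'J by (auto simp: q'_def y_def image_iff)
    qed
    show "general_position (q' ` insert j J)"
      unfolding im general_position_def
    proof (intro ballI impI)
      fix a b c assume abc: "a \<in> insert y (q ` J)" "b \<in> insert y (q ` J)" "c \<in> insert y (q ` J)" "distinct [a, b, c]"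
      then consider "a \<in> q ` J" "b \<in> q ` J" "c \<in> q ` J" | "c = y" "a \<in> q ` J" "b \<in> q ` J"
        | "a = y" "b \<in> q ` J" "c \<in> q ` J" | "b = y" "a \<in> q ` J" "c \<in> q ` J" by auto
      then show "ccw (fst a) (fst b) (fst c) \<noteq> 0"
      proof cases
        case 1
        then show ?thesis using q(3) abc(4) unfolding general_position_def by blast
      next
        case 2
        then show ?thesis using new[of a b] abc(4) by simp
      next
        case 3
        then show ?thesis using new[of b c] abc(4) ccw_cyclic(2)[of "fst b" "fst c" "fst a"] by (simp add: ccw_cyclic)
      next
        case 4
        then show ?thesis
          using new[of c a] abc(4) ccw_cyclic(2)[where a = "fst a" and b = "fst b" and c = "fst c"] by auto
      qed
    qed
  qed
qed

text \<open>Joins the polygonal arcs \<open>pl e\<close> along a walk; the common point of consecutive arcs is kept once.\<close>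

fun walk_polygon :: "('v \<Rightarrow> space) \<Rightarrow> ('v \<times> 'v \<Rightarrow> space list) \<Rightarrow> 'v list \<Rightarrow> space list" where
  "walk_polygon pos pl [] = []"
| "walk_polygon pos pl [v] = [pos v]"
| "walk_polygon pos pl (u # v # vs) = pl (u, v) @ tl (walk_polygon pos pl (v # vs))"

lemma walk_polygon_joins:
  assumes "vs \<noteq> []" "\<And>e. e \<in> set (steps vs) \<Longrightarrow> pl e \<noteq> [] \<and> hd (pl e) = pos (fst e) \<and> last (pl e) = pos (snd e)"
  shows "walk_polygon pos pl vs \<noteq> []" "hd (walk_polygon pos pl vs) = pos (hd vs)"
    "last (walk_polygon pos pl vs) = pos (last vs)"
    "steps (walk_polygon pos pl vs) = concat (map (\<lambda>e. steps (pl e)) (steps vs))"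
proof -
  let ?w = "walk_polygon pos pl"
  have "?w vs \<noteq> [] \<and> hd (?w vs) = pos (hd vs) \<and> last (?w vs) = pos (last vs) \<and>
      steps (?w vs) = concat (map (\<lambda>e. steps (pl e)) (steps vs))"
    using assms
  proof (induction vs rule: induct_list012)
    case (3 u v vs)
    have IH: "?w (v # vs) \<noteq> []" "hd (?w (v # vs)) = pos v" "last (?w (v # vs)) = pos (last (v # vs))"
      "steps (?w (v # vs)) = concat (map (\<lambda>e. steps (pl e)) (steps (v # vs)))"
      using "3.IH"(2) "3.prems"(2) by auto
    have e: "pl (u, v) \<noteq> []" "hd (pl (u, v)) = pos u" "last (pl (u, v)) = pos v"
      using "3.prems"(2)[of "(u, v)"] by auto
    have "last (pl (u, v) @ tl (?w (v # vs))) = last (?w (v # vs))"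
      using IH(1,2) e(3) by (cases "?w (v # vs)") auto
    then show ?case
      using e IH steps_append[of "pl (u, v)" "?w (v # vs)"] by simp
  qed auto
  then show "?w vs \<noteq> []" "hd (?w vs) = pos (hd vs)" "last (?w vs) = pos (last vs)"
    "steps (?w vs) = concat (map (\<lambda>e. steps (pl e)) (steps vs))"
    by auto
qed

lemma sum_list_concat_map:
  fixes f :: "'b \<Rightarrow> 'c::comm_monoid_add"
  shows "(\<Sum>x\<leftarrow>concat (map g xs). f x) = (\<Sum>y\<leftarrow>xs. \<Sum>x\<leftarrow>g y. f x)"
  by (induction xs) auto

lemma overcrossings_concat:
  assumes "steps xs = concat (map (\<lambda>e. steps (pl e)) as)" "steps ys = concat (map (\<lambda>e. steps (pl e)) bs)"
  shows "overcrossings xs ys = (\<Sum>e\<leftarrow>as. \<Sum>e'\<leftarrow>bs. overcrossings (pl e) (pl e'))"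
  unfolding overcrossings_def assms sum_list_concat_map
  by (rule arg_cong[of _ _ sum_list], rule map_cong[OF refl], rule sum_list_swap)

lemma set_walk_polygon:
  "set (walk_polygon pos pl vs) \<subseteq> pos ` set vs \<union> (\<Union>e\<in>set (steps vs). set (pl e))"
proof (induction vs rule: induct_list012)
  case (3 u v vs)
  have "set (tl (walk_polygon pos pl (v # vs))) \<subseteq> set (walk_polygon pos pl (v # vs))"
    by (cases "walk_polygon pos pl (v # vs)") auto
  then show ?case using "3.IH"(2) by auto
qed auto

lemma finite_uniform_bound:
  fixes Q :: "'a \<Rightarrow> real \<Rightarrow> bool"
  assumes "finite S" "\<And>p. p \<in> S \<Longrightarrow> \<exists>e>0. Q p e"
    and mono: "\<And>p e e'. Q p e \<Longrightarrow> e' \<le> e \<Longrightarrow> Q p e'"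
  shows "\<exists>e>0. \<forall>p\<in>S. Q p e"
  using assms(1,2)
proof (induction S)
  case empty
  show ?case by (intro exI[of _ 1]) auto
next
  case (insert x S)
  obtain e where e: "e > 0" "\<forall>p\<in>S. Q p e" using insert by blast
  obtain e' where e': "e' > 0" "Q x e'" using insert.prems by blast
  show ?case
    by (intro exI[of _ "min e e'"]) (use e e' mono in \<open>auto intro: mono\<close>)
qed

lemma path_uniform_subdivision:
  fixes c :: "'a \<Rightarrow> real \<Rightarrow> 'b::metric_space"
  assumes "finite A" "\<And>e. e \<in> A \<Longrightarrow> path (c e)" "\<epsilon> > 0"
  shows "\<exists>N>0. \<forall>e\<in>A. \<forall>j<N. dist (c e (real j / real N)) (c e (real (Suc j) / real N)) < \<epsilon>"
proof -
  let ?Q = "\<lambda>e d. \<forall>s\<in>{0..1}. \<forall>t\<in>{0..1}. dist s t < d \<longrightarrow> dist (c e s) (c e t) < \<epsilon>"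
  have "\<exists>d>0. \<forall>e\<in>A. ?Q e d"
  proof (rule finite_uniform_bound[OF assms(1)])
    fix e assume "e \<in> A"
    then have "uniformly_continuous_on {0..1} (c e)"
      using assms(2) unfolding path_def by (intro compact_uniformly_continuous) auto
    then obtain d where "d > 0" "\<forall>x\<in>{0..1}. \<forall>x'\<in>{0..1}. dist x' x < d \<longrightarrow> dist (c e x') (c e x) < \<epsilon>"
      using assms(3) unfolding uniformly_continuous_on_def by metis
    then show "\<exists>d>0. ?Q e d" by metis
  qed force
  then obtain d where d: "d > 0" "\<And>e s t. e \<in> A \<Longrightarrow> s \<in> {0..1} \<Longrightarrow> t \<in> {0..1} \<Longrightarrow> dist s t < d \<Longrightarrow> dist (c e s) (c e t) < \<epsilon>"
    by blast
  obtain N :: nat where N: "N > 0" "1 / real N < d"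
    using real_arch_inverse[of d] d(1) by (auto simp: inverse_eq_divide)
  show ?thesis
  proof (intro exI[of _ N] conjI ballI allI impI)
    fix e j assume "e \<in> A" "j < N"
    then show "dist (c e (real j / real N)) (c e (real (Suc j) / real N)) < \<epsilon>"
      using N by (intro d(2)) (auto simp: dist_real_def divide_simps)
  qed (rule N)
qed

text \<open>Labels for the subdivision points of the arc \<open>e\<close>.  Its ends get labels that depend on the vertex only, so that
  arcs with a common end share the sample point there.\<close>

definition sample :: "nat \<Rightarrow> 'v \<times> 'v \<Rightarrow> nat \<Rightarrow> 'v \<times> 'v \<times> nat" where
  "sample N e j = (if j = 0 then (fst e, fst e, 0) else if j = N then (snd e, snd e, 0) else (fst e, snd e, j))"

lemma sample_inj: "fst e \<noteq> snd e \<Longrightarrow> i \<le> N \<Longrightarrow> j \<le> N \<Longrightarrow> sample N e i = sample N e j \<Longrightarrow> i = j"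
  by (auto simp: sample_def split: if_splits)

lemma fst_sample: "fst (sample N e j) \<in> {fst e, snd e}"
  by (auto simp: sample_def)

lemma polygonal_approximation:
  fixes c :: "'v \<times> 'v \<Rightarrow> real \<Rightarrow> space" and \<phi> :: "'v \<Rightarrow> space"
  assumes fin: "finite A" and A: "\<And>e. e \<in> A \<Longrightarrow> fst e \<noteq> snd e"
    and c: "\<And>e. e \<in> A \<Longrightarrow> path (c e) \<and> pathstart (c e) = \<phi> (fst e) \<and> pathfinish (c e) = \<phi> (snd e)"
    and eps: "\<epsilon> > 0"
  shows "\<exists>N>0. \<exists>q. let I = (\<lambda>(e, j). sample N e j) ` (A \<times> {..N}) in
     inj_on (fst \<circ> q) I \<and> general_position (q ` I) \<and>
     (\<forall>e\<in>A. \<forall>j<N. \<exists>x\<in>path_image (c e).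
        closed_segment (q (sample N e j)) (q (sample N e (Suc j))) \<subseteq> ball x \<epsilon>)"
proof -
  have "\<epsilon> / 2 > 0" using eps by simp
  then obtain N where N: "N > 0"
    "\<And>e j. e \<in> A \<Longrightarrow> j < N \<Longrightarrow> dist (c e (real j / real N)) (c e (real (Suc j) / real N)) < \<epsilon> / 2"
    using path_uniform_subdivision[OF fin, of c "\<epsilon> / 2"] c by blast
  define I where "I = (\<lambda>(e, j). sample N e j) ` (A \<times> {..N})"
  \<comment> \<open>The points before the perturbation; a label with equal first components is that of a vertex.\<close>
  define r where "r = (\<lambda>(u, v, j). if u = v then \<phi> u else c (u, v) (real j / real N))"
  have r: "r (sample N e j) = c e (real j / real N)" if "e \<in> A" "j \<le> N" for e j
    using c[OF that(1)] A[OF that(1)] N(1) unfolding r_def sample_def pathstart_def pathfinish_def by auto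
  have "finite I" using fin by (simp add: I_def)
  then obtain q where q: "\<forall>i\<in>I. dist (q i) (r i) < \<epsilon> / 2" "inj_on (fst \<circ> q) I" "general_position (q ` I)"
    using perturb_to_general_position[OF _ \<open>\<epsilon> / 2 > 0\<close>] by blast
  have near: "\<exists>x\<in>path_image (c e). closed_segment (q (sample N e j)) (q (sample N e (Suc j))) \<subseteq> ball x \<epsilon>"
    if e: "e \<in> A" and j: "j < N" for e j
  proof
    let ?x = "c e (real j / real N)"
    show "?x \<in> path_image (c e)" using j by (auto simp: path_image_def)
    have q': "dist (q (sample N e i)) (c e (real i / real N)) < \<epsilon> / 2" if "i \<le> N" for i
    proof -
      have "sample N e i \<in> I" using e that by (force simp: I_def)
      then show ?thesis using q(1) r[OF e that] by metis
    qed
    have "dist ?x (q (sample N e j)) < \<epsilon>"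
      using q'[of j] j eps by (simp add: dist_commute)
    moreover have "dist ?x (q (sample N e (Suc j))) < \<epsilon>"
      using q'[of "Suc j"] N(2)[OF e j] j dist_triangle[of ?x "q (sample N e (Suc j))" "c e (real (Suc j) / real N)"]
      by (simp add: dist_commute del: of_nat_Suc)
    ultimately show "closed_segment (q (sample N e j)) (q (sample N e (Suc j))) \<subseteq> ball ?x \<epsilon>"
      by (intro closed_segment_subset convex_ball) auto
  qed
  show ?thesis
    unfolding Let_def
  proof (intro exI conjI ballI allI impI)
    show "inj_on (fst \<circ> q) ((\<lambda>(e, j). sample N e j) ` (A \<times> {..N}))"
      "general_position (q ` (\<lambda>(e, j). sample N e j) ` (A \<times> {..N}))"
      using q(2,3) unfolding I_def .
  qed (use N(1) near in blast)+
qed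

text \<open>If every pair of the list were separated, this would persist for polygonal approximations that
  are fine enough.  By \<open>log_separated_overcrossings_even\<close> every pair would then have an even number of
  overcrossings, against \<open>linking_certificate_obstruction\<close>.\<close>

theorem certificate_imp_inseparable_pair:
  fixes c :: "'v::linorder \<times> 'v \<Rightarrow> real \<Rightarrow> space" and \<phi> :: "'v \<Rightarrow> space"
  assumes cert: "linking_certificate P"
    and c: "\<And>C D e. (C, D) \<in> set P \<Longrightarrow> e \<in> set (steps C) \<union> set (steps D) \<Longrightarrow>
       fst e \<noteq> snd e \<and> path (c e) \<and> pathstart (c e) = \<phi> (fst e) \<and> pathfinish (c e) = \<phi> (snd e)"
  shows "\<exists>(C, D) \<in> set P. \<not> (\<exists>U V. logarithmically_separated U V \<and>
     (\<Union>e\<in>set (steps C). path_image (c e)) \<subseteq> U \<and> (\<Union>e\<in>set (steps D). path_image (c e)) \<subseteq> V)"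
proof (rule ccontr)
  assume "\<not> ?thesis"
  then have sep: "\<exists>U V. logarithmically_separated U V \<and> (\<Union>e\<in>set (steps C). path_image (c e)) \<subseteq> U \<and>
      (\<Union>e\<in>set (steps D). path_image (c e)) \<subseteq> V" if "(C, D) \<in> set P" for C D
    using that by blast
  define im where "im = (\<lambda>C. \<Union>e\<in>set (steps C). path_image (c e))"
  define A where "A = (\<Union>(C, D)\<in>set P. set (steps C) \<union> set (steps D))"
  have "finite A" by (auto simp: A_def)
  have A: "set (steps C) \<subseteq> A" "set (steps D) \<subseteq> A" if "(C, D) \<in> set P" for C D
    using that by (auto simp: A_def)
  have cA: "fst e \<noteq> snd e" "path (c e) \<and> pathstart (c e) = \<phi> (fst e) \<and> pathfinish (c e) = \<phi> (snd e)" if eA: "e \<in> A" for e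
  proof -
    obtain C D where "(C, D) \<in> set P" "e \<in> set (steps C) \<union> set (steps D)"
      using eA unfolding A_def by blast
    from c[OF this] show "fst e \<noteq> snd e" "path (c e) \<and> pathstart (c e) = \<phi> (fst e) \<and> pathfinish (c e) = \<phi> (snd e)"
      by simp_all
  qed
  have walks: "closed_walk C" "closed_walk D" "set C \<inter> set D = {}" if "(C, D) \<in> set P" for C D
    using linking_certificate_walks[OF cert that] by simp_all
  \<comment> \<open>One \<open>\<epsilon>\<close> serves all pairs: polygons that are \<open>\<epsilon>\<close>-close to the cycles stay in the open sides.\<close>
  let ?Q = "\<lambda>p \<epsilon>. \<exists>U V. logarithmically_separated U V \<and>
     (\<Union>x\<in>im (fst p). ball x \<epsilon>) \<subseteq> U \<and> (\<Union>x\<in>im (snd p). ball x \<epsilon>) \<subseteq> V"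
  have "\<exists>\<epsilon>>0. \<forall>p\<in>set P. ?Q p \<epsilon>"
  proof (rule finite_uniform_bound)
    fix p assume p: "p \<in> set P"
    obtain C D where p': "p = (C, D)" by (cases p)
    have cpt: "compact (im C)" "compact (im D)"
      unfolding im_def using A[of C D] p cA(2) unfolding p'
      by (auto intro!: compact_UN compact_path_image)
    obtain U V where UV: "logarithmically_separated U V" "im C \<subseteq> U" "im D \<subseteq> V"
      using sep p unfolding im_def p' by blast
    have "open U" "open V" using UV(1) unfolding logarithmically_separated_def by auto
    obtain e where e: "e > 0" "(\<Union>x\<in>im C. ball x e) \<subseteq> U"
      using compact_subset_open_imp_ball_epsilon_subset[OF cpt(1) \<open>open U\<close> UV(2)] by blast
    obtain e' where e': "e' > 0" "(\<Union>x\<in>im D. ball x e') \<subseteq> V"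
      using compact_subset_open_imp_ball_epsilon_subset[OF cpt(2) \<open>open V\<close> UV(3)] by blast
    have "(\<Union>x\<in>im C. ball x (min e e')) \<subseteq> U" "(\<Union>x\<in>im D. ball x (min e e')) \<subseteq> V"
      using e(2) e'(2) by fastforce+
    then show "\<exists>\<epsilon>>0. ?Q p \<epsilon>"
      using UV(1) e(1) e'(1) unfolding p' fst_conv snd_conv by (intro exI[of _ "min e e'"]) auto
  next
    fix p and e e' :: real assume "?Q p e" "e' \<le> e"
    moreover have "ball x e' \<subseteq> ball x e" for x :: space using \<open>e' \<le> e\<close> by (rule subset_ball)
    ultimately show "?Q p e'" by (meson UN_mono order_refl order_trans)
  qed simp
  then obtain \<epsilon> where eps: "\<epsilon> > 0" "\<And>p. p \<in> set P \<Longrightarrow> ?Q p \<epsilon>" by blast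
  obtain N q I where N: "N > 0" and I: "I = (\<lambda>(e, j). sample N e j) ` (A \<times> {..N})"
    and inj: "inj_on (fst \<circ> q) I" and gen: "general_position (q ` I)"
    and near: "\<And>e j. e \<in> A \<Longrightarrow> j < N \<Longrightarrow> \<exists>x\<in>path_image (c e).
        closed_segment (q (sample N e j)) (q (sample N e (Suc j))) \<subseteq> ball x \<epsilon>"
    using polygonal_approximation[OF \<open>finite A\<close> cA eps(1)] unfolding Let_def by blast
  define pos where "pos = (\<lambda>v. q (v, v, 0))"
  define pl where "pl = (\<lambda>e. map (\<lambda>j. q (sample N e j)) [0..<Suc N])"
  have ends: "pl e \<noteq> []" "hd (pl e) = pos (fst e)" "last (pl e) = pos (snd e)" for e
    using N by (auto simp: pl_def pos_def sample_def hd_map last_map simp del: upt_Suc)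
  have qI: "x = y" if "x \<in> I" "y \<in> I" "fst (q x) = fst (q y)" for x y
    using inj_onD[OF inj, of x y] that by simp
  have memI: "sample N e j \<in> I" if "e \<in> A" "j \<le> N" for e j
    using that by (force simp: I)
  have set_pl: "\<exists>i\<in>I. x = q i \<and> fst i \<in> {fst e, snd e}" if e: "e \<in> A" and x: "x \<in> set (pl e)" for e x
  proof -
    obtain j where "j \<le> N" "x = q (sample N e j)"
      using x unfolding pl_def set_map set_upt by (auto simp: less_Suc_eq_le)
    then show ?thesis using memI[OF e] fst_sample[of N e j] by blast
  qed
  have steps_pl: "a \<noteq> b \<and> (\<exists>x\<in>path_image (c e). closed_segment a b \<subseteq> ball x \<epsilon>)"
    if e: "e \<in> A" and ab: "(a, b) \<in> set (steps (pl e))" for a b e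
  proof -
    obtain j where j: "j < N" "a = q (sample N e j)" "b = q (sample N e (Suc j))"
      using ab unfolding pl_def steps_map_upt by auto
    have "sample N e j \<noteq> sample N e (Suc j)"
      using sample_inj[of e j N "Suc j"] cA(1)[OF e] j(1) by auto
    moreover have "sample N e j \<in> I" "sample N e (Suc j) \<in> I" using memI[OF e] j(1) by auto
    ultimately have "a \<noteq> b" using qI[of "sample N e j" "sample N e (Suc j)"] unfolding j(2,3) by auto
    then show ?thesis using near[OF e j(1)] j by simp
  qed
  have steps_near: "a \<noteq> b \<and> closed_segment a b \<subseteq> W"
    if e: "e \<in> set (steps C)" "e \<in> A" and ab: "(a, b) \<in> set (steps (pl e))"
      and W: "(\<Union>x\<in>im C. ball x \<epsilon>) \<subseteq> W" for a b e C W
  proof -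
    obtain x where x: "x \<in> path_image (c e)" "closed_segment a b \<subseteq> ball x \<epsilon>" and ne: "a \<noteq> b"
      using steps_pl[OF e(2) ab] by blast
    have "x \<in> im C" using x(1) e(1) unfolding im_def by blast
    then show ?thesis using x(2) W ne by blast
  qed
  let ?w = "walk_polygon pos pl"
  have closed: "closed_walk (?w C)" and steps_w: "steps (?w C) = concat (map (\<lambda>e. steps (pl e)) (steps C))"
    and set_w: "\<And>x. x \<in> set (?w C) \<Longrightarrow> \<exists>i\<in>I. x = q i \<and> fst i \<in> set C"
    if C: "closed_walk C" "set (steps C) \<subseteq> A" for C
  proof -
    have C2: "length C \<ge> 2" "C \<noteq> []" "last C = hd C" using C(1) by (auto simp: closed_walk_def)
    show st: "steps (?w C) = concat (map (\<lambda>e. steps (pl e)) (steps C))"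
      using walk_polygon_joins(4)[OF C2(2), of pl pos] ends by simp
    have "steps (pl e) \<noteq> []" for e using N by (simp add: pl_def steps_map_upt del: upt_Suc)
    moreover have "steps C \<noteq> []" using C2(1) by (simp add: steps_nonempty_iff)
    ultimately have "steps (?w C) \<noteq> []" unfolding st by (cases "steps C") auto
    then show "closed_walk (?w C)"
      using walk_polygon_joins(2,3)[OF C2(2), of pl pos] ends C2(3) unfolding closed_walk_def steps_nonempty_iff by simp
    fix x assume "x \<in> set (?w C)"
    then consider v where "v \<in> set C" "x = pos v" | e where "e \<in> set (steps C)" "x \<in> set (pl e)"
      using set_walk_polygon[of pos pl C] by blast
    then show "\<exists>i\<in>I. x = q i \<and> fst i \<in> set C"
    proof cases
      case 1
      then obtain e where e: "e \<in> set (steps C)" "v = fst e \<or> v = snd e"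
        using set_subset_steps[OF C2(1)] by auto
      then have "(v, v, 0) = sample N e 0 \<or> (v, v, 0) = sample N e N"
        using N by (auto simp: sample_def)
      then have "(v, v, 0) \<in> I" using memI e(1) C(2) by (metis le0 order_refl subsetD)
      then show ?thesis using 1 by (intro bexI[of _ "(v, v, 0)"]) (auto simp: pos_def)
    next
      case 2
      then obtain i where "i \<in> I" "x = q i" "fst i \<in> {fst e, snd e}" using set_pl C(2) by blast
      moreover have "fst e \<in> set C" "snd e \<in> set C" using 2(1) set_steps by (metis prod.collapse)+
      ultimately show ?thesis by auto
    qed
  qed
  have "even (\<Sum>e\<leftarrow>steps C. \<Sum>e'\<leftarrow>steps D. overcrossings (pl e) (pl e'))" if CD: "(C, D) \<in> set P" for C D
  proof -
    note C = walks(1)[OF CD] A(1)[OF CD] and D = walks(2)[OF CD] A(2)[OF CD]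
    obtain U V where UV: "logarithmically_separated U V" "(\<Union>x\<in>im C. ball x \<epsilon>) \<subseteq> U" "(\<Union>x\<in>im D. ball x \<epsilon>) \<subseteq> V"
      using eps(2)[OF CD] by auto
    have "even (overcrossings (?w C) (?w D))"
    proof (rule log_separated_overcrossings_even[OF UV(1)])
      show "closed_walk (?w C)" "closed_walk (?w D)" using closed C D by blast+
      show "a \<noteq> b \<and> closed_segment a b \<subseteq> U" if ab: "(a, b) \<in> set (steps (?w C))" for a b
      proof -
        obtain e where "e \<in> set (steps C)" "(a, b) \<in> set (steps (pl e))"
          using ab unfolding steps_w[OF C] by auto
        then show ?thesis using steps_near C(2) UV(2) by blast
      qed
      show "a \<noteq> b \<and> closed_segment a b \<subseteq> V" if ab: "(a, b) \<in> set (steps (?w D))" for a b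
      proof -
        obtain e where "e \<in> set (steps D)" "(a, b) \<in> set (steps (pl e))"
          using ab unfolding steps_w[OF D] by auto
        then show ?thesis using steps_near D(2) UV(3) by blast
      qed
      have "set (?w C) \<union> set (?w D) \<subseteq> q ` I" using set_w[OF C] set_w[OF D] by blast
      then show "general_position (set (?w C) \<union> set (?w D))"
        using general_position_subset[OF gen] by blast
      show "set (?w C) \<inter> set (?w D) = {}"
      proof (rule ccontr)
        assume "set (?w C) \<inter> set (?w D) \<noteq> {}"
        then obtain i j where "i \<in> I" "j \<in> I" "q i = q j" "fst i \<in> set C" "fst j \<in> set D"
          using set_w[OF C] set_w[OF D] by (metis disjoint_iff)
        then show False using qI[of i j] walks(3)[OF CD] by auto
      qed
    qed
    then show ?thesis using overcrossings_concat[OF steps_w[OF C] steps_w[OF D]] by simp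
  qed
  moreover
  define m where "m = (\<lambda>w e. SOME m::int.
     turning (pos w) (pl e) = direction pos w (snd e) - direction pos w (fst e) + 2 * pi * m)"
  have "\<exists>(C, D) \<in> set P. odd (\<Sum>e\<leftarrow>steps C. \<Sum>e'\<leftarrow>steps D. overcrossings (pl e) (pl e'))"
  proof (rule linking_certificate_obstruction[OF cert, where m = m])
    fix e e' assume "(e, e') \<in> set (opposite_arcs P)"
    then obtain C D where CD: "(C, D) \<in> set P" "e \<in> set (steps C)" "e' \<in> set (steps D)"
      by (auto simp: opposite_arcs_def)
    note C = walks(1)[OF CD(1)] A(1)[OF CD(1)] and D = walks(2)[OF CD(1)] A(2)[OF CD(1)]
    have eA: "e \<in> A" "e' \<in> A" using CD C(2) D(2) by auto
    have "fst e \<in> set C" "snd e \<in> set C" "fst e' \<in> set D" "snd e' \<in> set D"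
      using CD(2,3) set_steps by (metis prod.collapse)+
    then have ends': "{fst e, snd e} \<inter> {fst e', snd e'} = {}" using walks(3)[OF CD(1)] by auto
    have posI: "(w, w, 0) \<in> I" if "w \<in> {fst e, snd e} \<union> {fst e', snd e'}" for w
    proof -
      have "(w, w, 0) \<in> {sample N e 0, sample N e N, sample N e' 0, sample N e' N}"
        using that N by (auto simp: sample_def)
      then show ?thesis
        using memI[OF eA(1), of 0] memI[OF eA(1), of N] memI[OF eA(2), of 0] memI[OF eA(2), of N] by auto
    qed
    have turn: "turning (pos w) (pl d) = direction pos w (snd d) - direction pos w (fst d) + 2 * pi * of_int (m w d)"
      if d: "d \<in> A" and w: "w \<notin> {fst d, snd d}" "(w, w, 0) \<in> I" for w d
    proof -
      have "\<exists>m::int. turning (pos w) (pl d) = direction pos w (snd d) - direction pos w (fst d) + 2 * pi * m"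
      proof (rule turning_eq_direction_difference)
        fix y assume "y \<in> set (pl d)"
        then obtain i where i: "i \<in> I" "y = q i" "fst i \<in> {fst d, snd d}" using set_pl[OF d] by blast
        show "fst y \<noteq> fst (pos w)" using qI[OF i(1) w(2)] i w(1) by (auto simp: pos_def)
      qed (use ends w(1) in auto)
      then show ?thesis unfolding m_def by (rule someI_ex)
    qed
    obtain U V where UV: "logarithmically_separated U V" "(\<Union>x\<in>im C. ball x \<epsilon>) \<subseteq> U" "(\<Union>x\<in>im D. ball x \<epsilon>) \<subseteq> V"
      using eps(2)[OF CD(1)] by auto
    show "odd (overcrossings (pl e) (pl e') + overcrossings (pl e') (pl e)) \<longleftrightarrow>
       odd (interlacing e e' + (m (fst e) e' + m (snd e) e') + (m (fst e') e + m (snd e') e))"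
    proof (rule arc_crossing_parity[OF ends ends ends'])
      have "set (pl e) \<union> set (pl e') \<subseteq> q ` I" using set_pl eA by blast
      then show "general_position (set (pl e) \<union> set (pl e'))"
        using general_position_subset[OF gen] by blast
      show "set (pl e) \<inter> set (pl e') = {}"
      proof (rule ccontr)
        assume "set (pl e) \<inter> set (pl e') \<noteq> {}"
        then obtain x where x: "x \<in> set (pl e)" "x \<in> set (pl e')" by blast
        obtain i j where "i \<in> I" "j \<in> I" "x = q i" "x = q j" "fst i \<in> {fst e, snd e}" "fst j \<in> {fst e', snd e'}"
          using set_pl[OF eA(1) x(1)] set_pl[OF eA(2) x(2)] by blast
        then show False using qI[of i j] ends' by auto
      qed
      show "a \<noteq> b" if "(a, b) \<in> set (steps (pl e)) \<union> set (steps (pl e'))" for a b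
        using that steps_pl[OF eA(1)] steps_pl[OF eA(2)] by blast
      show "closed_segment a b \<inter> closed_segment a' b' = {}"
        if "(a, b) \<in> set (steps (pl e))" "(a', b') \<in> set (steps (pl e'))" for a b a' b'
      proof -
        have "closed_segment a b \<subseteq> U" "closed_segment a' b' \<subseteq> V"
          using steps_near[OF CD(2) eA(1) that(1) UV(2)] steps_near[OF CD(3) eA(2) that(2) UV(3)] by simp_all
        then show ?thesis using UV(1) unfolding logarithmically_separated_def by blast
      qed
      show "turning (pos w) (pl e') = direction pos w (snd e') - direction pos w (fst e') + 2 * pi * of_int (m w e')"
        if "w \<in> {fst e, snd e}" for w
        using that ends' eA posI by (intro turn) auto
      show "turning (pos w) (pl e) = direction pos w (snd e) - direction pos w (fst e) + 2 * pi * of_int (m w e)"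
        if "w \<in> {fst e', snd e'}" for w
        using that ends' eA posI by (intro turn) auto
    qed
  qed
  ultimately show False by blast
qed

section \<open>Intrinsic linking from a certificate\<close>

lemma cycle_steps:
  fixes G :: "('v, 'v \<times> 'v) pre_digraph"
  assumes ends: "tail G = fst" "head G = snd"
    and C: "closed_walk C" "distinct (tl C)" "set (steps C) \<subseteq> arcs G" "set C \<subseteq> verts G"
  shows "pre_digraph.cycle G (steps C)"
proof -
  have ne: "C \<noteq> []" and "steps C \<noteq> []" "last C = hd C"
    using C(1) by (auto simp: closed_walk_def steps_nonempty_iff)
  have "pre_digraph.cas G (hd xs) (steps xs) (last xs) \<and> pre_digraph.awalk_verts G (hd xs) (steps xs) = xs"
    if "xs \<noteq> []" for xs
    using that
    by (induction xs rule: induct_list012) (auto simp: ends pre_digraph.cas.simps pre_digraph.awalk_verts.simps)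
  note * = this[OF ne]
  show ?thesis
    unfolding pre_digraph.cycle_def pre_digraph.awalk_def
    using * C ne \<open>last C = hd C\<close> \<open>steps C \<noteq> []\<close> hd_in_set[OF ne] by (intro exI[of _ "hd C"]) auto
qed

text \<open>The homeomorphism from the punctured sphere carries an embedding into \<open>\<real>\<^sup>3\<close>, where
  \<open>certificate_imp_inseparable_pair\<close> applies, and a splitting sphere to logarithmically separated sets.\<close>

theorem certificate_imp_intrinsically_linked:
  fixes G :: "('v::linorder, 'v \<times> 'v) pre_digraph"
  assumes "loopfree_digraph G" and ends: "tail G = fst" "head G = snd"
    and cert: "linking_certificate P"
    and cyc: "\<And>C D. (C, D) \<in> set P \<Longrightarrow> distinct (tl C) \<and> distinct (tl D) \<and>
        set (steps C) \<subseteq> arcs G \<and> set (steps D) \<subseteq> arcs G"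
  shows "intrinsically_linked G"
  unfolding intrinsically_linked_def
proof (intro allI impI)
  interpret loopfree_digraph G by fact
  fix \<phi> :: "'v \<Rightarrow> real^4" and \<gamma> :: "'v \<times> 'v \<Rightarrow> real \<Rightarrow> real^4"
  assume "tame_embedding G \<phi> \<gamma>"
  then obtain p h k where emb: "digraph_embedding G \<phi> \<gamma>"
    and p: "p \<notin> (\<Union>e\<in>arcs G. path_image (\<gamma> e))"
    and hom: "homeomorphism (S3 - {p}) (UNIV :: (real^3) set) h k"
    unfolding tame_embedding_def by blast
  \<comment> \<open>Any identification of the two models of \<open>\<real>\<^sup>3\<close> will do.\<close>
  have "(UNIV :: (real^3) set) homeomorphic (UNIV :: space set)"
    by (rule homeomorphic_subspaces) auto
  then obtain f g where fg: "homeomorphism (UNIV :: (real^3) set) (UNIV :: space set) f g"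
    unfolding homeomorphic_def by blast
  define h' where "h' = f \<circ> h"
  have hom': "homeomorphism (S3 - {p}) (UNIV :: space set) h' (k \<circ> g)"
    unfolding h'_def by (rule homeomorphism_compose[OF hom fg])
  have cont: "continuous_on (S3 - {p}) h'" using hom' by (simp add: homeomorphism_def)
  have \<gamma>: "path (\<gamma> e)" "path_image (\<gamma> e) \<subseteq> S3 - {p}" "pathstart (\<gamma> e) = \<phi> (fst e)" "pathfinish (\<gamma> e) = \<phi> (snd e)"
    if "e \<in> arcs G" for e
    using emb p that ends unfolding digraph_embedding_def by (auto intro: simple_path_imp_path)
  have walks: "closed_walk C" "closed_walk D" "set C \<inter> set D = {}" if "(C, D) \<in> set P" for C D
    using linking_certificate_walks[OF cert that] by simp_all
  have "\<exists>(C, D) \<in> set P. \<not> (\<exists>U V. logarithmically_separated U V \<and>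
     (\<Union>e\<in>set (steps C). path_image (h' \<circ> \<gamma> e)) \<subseteq> U \<and> (\<Union>e\<in>set (steps D). path_image (h' \<circ> \<gamma> e)) \<subseteq> V)"
  proof (rule certificate_imp_inseparable_pair[OF cert, where \<phi> = "h' \<circ> \<phi>"])
    fix C D e assume "(C, D) \<in> set P" "e \<in> set (steps C) \<union> set (steps D)"
    then have e: "e \<in> arcs G" using cyc by blast
    show "fst e \<noteq> snd e \<and> path (h' \<circ> \<gamma> e) \<and> pathstart (h' \<circ> \<gamma> e) = (h' \<circ> \<phi>) (fst e) \<and>
        pathfinish (h' \<circ> \<gamma> e) = (h' \<circ> \<phi>) (snd e)"
      using \<gamma>[OF e] no_loops[OF e] ends path_continuous_image[OF \<gamma>(1)[OF e] continuous_on_subset[OF cont \<gamma>(2)[OF e]]]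
      by (simp add: pathstart_compose pathfinish_compose)
  qed
  then obtain C D where CD: "(C, D) \<in> set P" and insep: "\<not> (\<exists>U V. logarithmically_separated U V \<and>
     (\<Union>e\<in>set (steps C). path_image (h' \<circ> \<gamma> e)) \<subseteq> U \<and> (\<Union>e\<in>set (steps D). path_image (h' \<circ> \<gamma> e)) \<subseteq> V)"
    by blast
  have arcs: "set (steps C) \<subseteq> arcs G" "set (steps D) \<subseteq> arcs G" "distinct (tl C)" "distinct (tl D)"
    using cyc[OF CD] by auto
  have verts: "set xs \<subseteq> verts G" "cycle_verts G (steps xs) \<subseteq> set xs"
    if "closed_walk xs" "set (steps xs) \<subseteq> arcs G" for xs
    using that set_subset_steps[of xs] wellformed ends
    unfolding closed_walk_def cycle_verts_def by force+
  have img: "(\<Union>e\<in>set (steps xs). path_image (h' \<circ> \<gamma> e)) = h' ` cycle_image \<gamma> (steps xs)" for xs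
    unfolding cycle_image_def path_image_compose by blast
  show "\<exists>c d. pre_digraph.cycle G c \<and> pre_digraph.cycle G d \<and> cycle_verts G c \<inter> cycle_verts G d = {} \<and>
      \<not> split_link (cycle_image \<gamma> c) (cycle_image \<gamma> d)"
  proof (intro exI conjI)
    show "pre_digraph.cycle G (steps C)" "pre_digraph.cycle G (steps D)"
      using cycle_steps[OF ends] walks[OF CD] arcs verts(1) by blast+
    show "cycle_verts G (steps C) \<inter> cycle_verts G (steps D) = {}"
      using verts(2)[of C] verts(2)[of D] walks[OF CD] arcs by blast
    have "p \<notin> cycle_image \<gamma> (steps C) \<union> cycle_image \<gamma> (steps D)"
      using p arcs unfolding cycle_image_def by blast
    then show "\<not> split_link (cycle_image \<gamma> (steps C)) (cycle_image \<gamma> (steps D))"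
      using split_link_logarithmically_separated[OF _ _ hom'] insep unfolding img by blast
  qed
qed

section \<open>One linked digraph inside all the tournaments\<close>

definition list_digraph :: "nat \<Rightarrow> (nat \<times> nat) list \<Rightarrow> (nat, nat \<times> nat) pre_digraph" where
  "list_digraph n es = \<lparr>verts = {..<n}, arcs = set es, tail = fst, head = snd\<rparr>"

definition tournament_list :: "nat \<Rightarrow> (nat \<times> nat) list \<Rightarrow> bool" where
  "tournament_list n es \<longleftrightarrow> distinct es \<and> (\<forall>(u, v) \<in> set es. u < n \<and> v < n \<and> u \<noteq> v) \<and>
     (\<forall>u \<in> set [0..<n]. \<forall>v \<in> set [0..<n]. u \<noteq> v \<longrightarrow> (u, v) \<in> set es \<longleftrightarrow> (v, u) \<notin> set es)"

lemma tournament_list_digraph: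
  assumes "tournament_list n es"
  shows "tournament (list_digraph n es)"
proof
  fix e assume "e \<in> arcs (list_digraph n es)"
  then have "fst e < n \<and> snd e < n \<and> fst e \<noteq> snd e"
    using assms unfolding list_digraph_def tournament_list_def by (cases e) auto
  then show "tail (list_digraph n es) e \<in> verts (list_digraph n es)"
    "head (list_digraph n es) e \<in> verts (list_digraph n es)"
    "tail (list_digraph n es) e \<noteq> head (list_digraph n es) e"
    by (auto simp: list_digraph_def)
next
  fix u v assume "u \<in> verts (list_digraph n es)" "v \<in> verts (list_digraph n es)" and ne: "u \<noteq> v"
  then have "u \<in> set [0..<n]" "v \<in> set [0..<n]" by (simp_all add: list_digraph_def)
  then have "(u, v) \<in> set es \<longleftrightarrow> (v, u) \<notin> set es"
    using assms ne unfolding tournament_list_def by blast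
  moreover have "u \<rightarrow>\<^bsub>list_digraph n es\<^esub> v \<longleftrightarrow> (u, v) \<in> set es" for u v
    by (auto simp: list_digraph_def arcs_ends_conv image_iff)
  ultimately show "u \<rightarrow>\<^bsub>list_digraph n es\<^esub> v \<longleftrightarrow> \<not> v \<rightarrow>\<^bsub>list_digraph n es\<^esub> u"
    by blast
qed (auto simp: list_digraph_def arc_to_ends_def)

lemma score_sequence_list_digraph:
  assumes "distinct es"
  shows "score_sequence (list_digraph n es) = sort (map (\<lambda>v. length (filter (\<lambda>e. fst e = v) es)) [0..<n])"
proof -
  have deg: "out_degree (list_digraph n es) v = length (filter (\<lambda>e. fst e = v) es)" for v
  proof -
    have "out_arcs (list_digraph n es) v = set (filter (\<lambda>e. fst e = v) es)"
      by (auto simp: out_arcs_def list_digraph_def)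
    then show ?thesis
      unfolding out_degree_def using distinct_card[OF distinct_filter[OF assms]] by simp
  qed
  have "mset_set {..<n} = mset [0..<n]"
    using mset_set_set[of "[0..<n]"] by (simp add: lessThan_atLeast0)
  then have "image_mset (out_degree (list_digraph n es)) (mset_set (verts (list_digraph n es)))
      = mset (map (out_degree (list_digraph n es)) [0..<n])"
    by (simp add: list_digraph_def)
  then show ?thesis
    unfolding score_sequence_def deg by (simp add: sorted_list_of_multiset_mset del: mset_map)
qed

text \<open>Toggles the membership of \<open>x\<close>.  Folding \<open>cancel\<close> over a list decides quickly whether every entry
  occurs an even number of times.\<close>

fun cancel :: "'a \<Rightarrow> 'a list \<Rightarrow> 'a list" where
  "cancel x [] = [x]"
| "cancel x (y # ys) = (if x = y then ys else y # cancel x ys)"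

lemma even_count_fold_cancel:
  "even (count_list (fold cancel xs ys) z) \<longleftrightarrow> even (count_list xs z + count_list ys z)"
proof (induction xs arbitrary: ys)
  case (Cons x xs)
  have "even (count_list (cancel x ys) z) \<longleftrightarrow> even (count_list (x # ys) z)" for ys
    by (induction ys) auto
  then show ?case using Cons by auto
qed simp

lemma even_count_of_cancel:
  fixes X :: "(('v::linorder \<times> 'v) \<times> ('v \<times> 'v)) list"
  assumes cancel: "fold cancel (map (\<lambda>(e, e'). if fst e < fst e' then (e, e') else (e', e)) X) [] = []"
    and x: "fst (fst x) \<noteq> fst (snd x)"
  shows "even (count_list X x + count_list X (prod.swap x))"
proof -
  define orient where "orient = (\<lambda>(e, e'). if fst e < fst (e' :: 'v \<times> 'v) then (e, e') else (e', e))"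
  have orient: "orient y = (if fst (fst y) < fst (snd y) then y else prod.swap y)" for y
    by (simp add: orient_def case_prod_unfold prod.swap_def)
  have key: "orient y = orient x \<longleftrightarrow> y = x \<or> y = prod.swap x" for y
    using x unfolding orient by (cases x; cases y) (auto simp: not_less order_le_less)
  have "x \<noteq> prod.swap x" using x by (cases x) auto
  then have "count_list (map orient X) (orient x) = count_list X x + count_list X (prod.swap x)"
    by (induction X) (use key in auto)
  moreover have "even (count_list (map orient X) y)" for y
    using even_count_fold_cancel[of "map orient X" "[]" y] unfolding orient_def cancel by simp
  ultimately show ?thesis by metis
qed

text \<open>The blow-up of a directed triangle with parts of sizes three, two and three, with one arc reversed.\<close>

definition core_arcs :: "(nat \<times> nat) list" where
  "core_arcs = List.product [0, 1, 2] [3, 4] @ List.product [3, 4] [5, 6, 7] @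
     remove1 (7, 2) (List.product [5, 6, 7] [0, 1, 2]) @ [(2, 7)]"

text \<open>The pairs of disjoint directed cycles of \<open>core_arcs\<close> that use both or none of \<open>2\<close> and \<open>7\<close>: two
  triangles that avoid both, two triangles with \<open>7\<close> on the first and \<open>2\<close> on the second, or a triangle and
  a pentagon through the reversed arc \<open>(2, 7)\<close>.\<close>

definition linked_cycles :: "(nat list \<times> nat list) list" where
  "linked_cycles =
     [([0, y, z, 0], [1, y', z', 1]). (y, y') \<leftarrow> [(3, 4), (4, 3)], (z, z') \<leftarrow> [(5, 6), (6, 5)]] @
     [([x, y, 7, x], [2, y', z, 2]). x \<leftarrow> [0, 1], (y, y') \<leftarrow> [(3, 4), (4, 3)], z \<leftarrow> [5, 6]] @
     [([x, y, z, x], [2, 7, x', y', z', 2]).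
        (x, x') \<leftarrow> [(0, 1), (1, 0)], (y, y') \<leftarrow> [(3, 4), (4, 3)], (z, z') \<leftarrow> [(5, 6), (6, 5)]]"

lemma linked_cycles_certificate: "linking_certificate linked_cycles"
proof -
  have "\<forall>(C, D) \<in> set linked_cycles. closed_walk C \<and> closed_walk D \<and> set C \<inter> set D = {}"
    by code_simp
  moreover have "even (count_list (opposite_arcs linked_cycles) x + count_list (opposite_arcs linked_cycles) (prod.swap x))"
    if x: "x \<in> set (opposite_arcs linked_cycles)" for x
  proof (rule even_count_of_cancel)
    show "fold cancel (map (\<lambda>(e, e'). if fst e < fst e' then (e, e') else (e', e)) (opposite_arcs linked_cycles)) [] = []"
      by code_simp
    have "\<forall>x \<in> set (opposite_arcs linked_cycles). fst (fst x) \<noteq> fst (snd x)"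
      by code_simp
    then show "fst (fst x) \<noteq> fst (snd x)" using x by blast
  qed
  moreover have "odd (\<Sum>(e, e')\<leftarrow>filter (\<lambda>(e, e'). fst e < fst e') (opposite_arcs linked_cycles). interlacing e e')"
    by code_simp
  ultimately show ?thesis
    unfolding linking_certificate_def by blast
qed

lemma linked_cycles_directed:
  "\<forall>(C, D) \<in> set linked_cycles. distinct (tl C) \<and> distinct (tl D) \<and>
     set (steps C) \<subseteq> set core_arcs \<and> set (steps D) \<subseteq> set core_arcs"
  by code_simp

text \<open>The linked cycles lie in \<open>core_arcs\<close>, which leaves the arcs within the three parts free to produce
  different scores.\<close>

lemma core_extension_represents:
  assumes t: "tournament_list 8 (core_arcs @ es)"
    and S: "sort (map (\<lambda>v. length (filter (\<lambda>e. fst e = v) (core_arcs @ es))) [0..<8]) = S"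
  shows "has_intrinsically_linked_representative S"
proof -
  let ?G = "list_digraph 8 (core_arcs @ es)"
  interpret tournament ?G by (rule tournament_list_digraph[OF t])
  have "intrinsically_linked ?G"
  proof (rule certificate_imp_intrinsically_linked[OF _ _ _ linked_cycles_certificate])
    show "loopfree_digraph ?G" by (rule loopfree_digraph_axioms)
    fix C D assume "(C, D) \<in> set linked_cycles"
    then show "distinct (tl C) \<and> distinct (tl D) \<and> set (steps C) \<subseteq> arcs ?G \<and> set (steps D) \<subseteq> arcs ?G"
      using linked_cycles_directed by (auto simp: list_digraph_def)
  qed (simp_all add: list_digraph_def)
  moreover have "score_sequence ?G = S"
    using score_sequence_list_digraph[of "core_arcs @ es" 8] t S by (simp add: tournament_list_def)
  ultimately show ?thesis
    unfolding has_intrinsically_linked_representative_def using tournament_axioms by blast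
qed

theorem proposition3p1:
  fixes S :: "nat list"
  assumes "S \<in> {[2,3,3,4,4,4,4,4], [2,3,3,3,4,4,4,5], [3,3,3,3,4,4,4,4],
                [3,3,3,3,3,4,4,5], [2,2,3,3,4,4,5,5], [2,2,3,4,4,4,4,5]}"
  shows "has_intrinsically_linked_representative S \<and>
         has_intrinsically_linked_representative (dual_sequence S)"
proof -
  let ?rep = has_intrinsically_linked_representative
  have r1: "?rep [2,3,3,4,4,4,4,4]"
    by (rule core_extension_represents[of "[(0, 1), (0, 2), (2, 1), (3, 4), (5, 6), (7, 5), (6, 7)]"]) code_simp+
  have r2: "?rep [2,3,3,3,4,4,4,5]"
    by (rule core_extension_represents[of "[(0, 1), (0, 2), (1, 2), (3, 4), (5, 6), (5, 7), (6, 7)]"]) code_simp+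
  have r3: "?rep [3,3,3,3,4,4,4,4]"
    by (rule core_extension_represents[of "[(0, 1), (0, 2), (1, 2), (3, 4), (5, 6), (7, 5), (6, 7)]"]) code_simp+
  have r4: "?rep [3,3,3,3,3,4,4,5]"
    by (rule core_extension_represents[of "[(0, 1), (0, 2), (1, 2), (3, 4), (5, 6), (5, 7), (7, 6)]"]) code_simp+
  have r5: "?rep [2,2,3,3,4,4,5,5]"
    by (rule core_extension_represents[of "[(0, 1), (2, 0), (2, 1), (3, 4), (5, 6), (5, 7), (6, 7)]"]) code_simp+
  have r6: "?rep [2,2,3,4,4,4,4,5]"
    by (rule core_extension_represents[of "[(0, 1), (0, 2), (2, 1), (3, 4), (5, 6), (5, 7), (6, 7)]"]) code_simp+
  have r7: "?rep [2,3,3,3,3,4,5,5]"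
    by (rule core_extension_represents[of "[(0, 1), (2, 0), (2, 1), (3, 4), (5, 6), (5, 7), (7, 6)]"]) code_simp+
  have dual: "dual_sequence [2,3,3,4,4,4,4,4] = [3,3,3,3,3,4,4,5]"
    "dual_sequence [2,3,3,3,4,4,4,5] = [2,3,3,3,4,4,4,5]"
    "dual_sequence [3,3,3,3,4,4,4,4] = [3,3,3,3,4,4,4,4]"
    "dual_sequence [3,3,3,3,3,4,4,5] = [2,3,3,4,4,4,4,4]"
    "dual_sequence [2,2,3,3,4,4,5,5] = [2,2,3,3,4,4,5,5]"
    "dual_sequence [2,2,3,4,4,4,4,5] = [2,3,3,3,3,4,5,5]"
    by code_simp+
  show ?thesis
    using assms r1 r2 r3 r4 r5 r6 r7 dual by auto
qed

end
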